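(* Let $(X,g,I)$ be a compact irreducible hyper-Kähler manifold of complex dimension $2d$, where $I$ is one of its complex structures, with associated Kähler form $\omega_I$. Let $\sigma : X \to X$ be an involution that is anti-holomorphic with respect to $I$ and satisfies $\sigma^*\omega_I = -\omega_I$. Fix $\theta \in H^0(X,\Omega_X^2)\setminus\{0\}$ (holomorphic with respect to $I$) such that $\sigma^*\theta = \overline{\theta}$ and the pointwise norm of $\theta$ with respect to $g$ is $2\sqrt{d}$. Let $J, K$ be the complex structures on $X$ determined by $\mathrm{Re}(\theta)(\alpha,\beta) = g(J\alpha,\beta)$ and $\mathrm{Im}(\theta)(\alpha,\beta) = g(K\alpha,\beta)$ for real tangent vectors $\alpha,\beta$, let $\omega_J = \mathrm{Re}(\theta)$ and $\omega_K = \mathrm{Im}(\theta)$ be the Kähler forms for $(J,g)$ and $(K,g)$, and put $\theta_J = \omega_K + \sqrt{-1}\,\omega_I$ and $\theta_K = \omega_J + \sqrt{-1}\,\omega_I$. Assume that the fixed point locus $S = X^\sigma \subset X$ is nonempty. Then: (1) $S$ is a special Lagrangian submanifold with respect to both $(\omega_I,\theta^d)$ and $(\omega_K,\theta_K^d)$; (2) $S$ is a complex Lagrangian submanifold with respect to $(J,\theta_J)$.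
   Context: A hyper-Kähler manifold is a connected smooth manifold $X$ with a Riemannian metric $g$ and integrable almost complex structures $I, J_0, K_0$, all orthogonal with respect to $g$, whose Hermitian forms are closed, and satisfying $K_0 = IJ_0 = -J_0I$, $J_0=-IK_0=K_0I$ and $I=J_0K_0=-K_0J_0$. If $\dim_{\mathbb R}X = 4d$, it is irreducible if the Levi-Civita connection of $g$ has holonomy $\mathrm{Sp}(d)$. The Kähler form of $(I,g)$ is $\omega_I(\alpha,\beta) = g(I\alpha,\beta)$, and similarly for the other complex structures. $\Omega_X^2$ is the bundle of holomorphic $2$-forms with respect to $I$. In the claim, $J$ and $K$ denote the structures determined by $\theta$ (not necessarily the originally given $J_0, K_0$); for $\theta$ as in the claim these are integrable, orthogonal almost complex structures with $(X,J,g)$ and $(X,K,g)$ Kähler. The pointwise norm on complex $2$-forms is the Hermitian norm induced by $g$ in which $e^i\wedge e^j$ ($i<j$) is an orthonormal basis whenever $(e^i)$ is a $g$-orthonormal coframe. An involution $\sigma$ is a diffeomorphism with $\sigma\circ\sigma = \mathrm{Id}_X$; it is anti-holomorphic with respect to $I$ if $d\sigma\circ I = -I\circ d\sigma$. $X^\sigma$ is the set of points fixed by $\sigma$. A submanifold $S$ of real dimension $2d$ (possibly disconnected) with inclusion $\iota: S\hookrightarrow X$ is special Lagrangian with respect to $(\omega,\Theta)$, where $\omega$ is a Kähler form and $\Theta$ is a complex $2d$-form, if $\iota^*\omega = 0$ and $\iota^*\mathrm{Im}(\Theta) = 0$. Here $\theta^d$ denotes the $d$-th exterior power. $S$ is complex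 Lagrangian with respect to $(J,\theta_J)$ if it is a complex submanifold of $(X,J)$ of complex dimension $d$ with $\iota^*\theta_J = 0$. *)

theory Defs
  imports "HOL-Analysis.Analysis" "HOL-Combinatorics.Combinatorics"
begin

section \<open>Smooth functions on open subsets of normed spaces\<close>

text \<open>Only used for open \<^term>\<open>S\<close>.\<close>

primrec Ck_on :: "nat \<Rightarrow> 'a::real_normed_vector set \<Rightarrow> ('a \<Rightarrow> 'b::real_normed_vector) \<Rightarrow> bool" where
  "Ck_on 0 S f \<longleftrightarrow> continuous_on S f"
| "Ck_on (Suc k) S f \<longleftrightarrow>
     (\<forall>x\<in>S. f differentiable (at x)) \<and> (\<forall>v. Ck_on k S (\<lambda>x. frechet_derivative f (at x) v))"

definition smooth_on :: "'a::real_normed_vector set \<Rightarrow> ('a \<Rightarrow> 'b::real_normed_vector) \<Rightarrow> bool" where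
  "smooth_on S f \<longleftrightarrow> (\<forall>k. Ck_on k S f)"


section \<open>Smooth manifolds\<close>

text \<open>A chart is a pair \<open>(U, \<phi>)\<close> of an open set and a homeomorphism of \<open>U\<close> onto an open subset
  of the model space; values of \<open>\<phi>\<close> outside \<open>U\<close> are irrelevant. The manifold itself is the whole
  type \<open>'a\<close>, and its dimension is the dimension of the model space \<open>'e\<close>.\<close>

type_synonym ('a, 'e) chart = "'a set \<times> ('a \<Rightarrow> 'e)"

definition is_chart :: "('a::topological_space, 'e::euclidean_space) chart \<Rightarrow> bool" where
  "is_chart c \<longleftrightarrow> open (fst c) \<and> open (snd c ` fst c) \<and>
     (\<exists>\<psi>. homeomorphism (fst c) (snd c ` fst c) (snd c) \<psi>)"

definition cinv :: "('a, 'e) chart \<Rightarrow> 'e \<Rightarrow> 'a" where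
  "cinv c = inv_into (fst c) (snd c)"

definition compatible ::
    "('a::topological_space, 'e::euclidean_space) chart \<Rightarrow> ('a, 'e) chart \<Rightarrow> bool" where
  "compatible c c' \<longleftrightarrow>
     smooth_on (snd c ` (fst c \<inter> fst c')) (snd c' \<circ> cinv c) \<and>
     smooth_on (snd c' ` (fst c \<inter> fst c')) (snd c \<circ> cinv c')"

text \<open>A smooth structure is a maximal smooth atlas.\<close>

definition smooth_structure ::
    "('a::{t2_space,second_countable_topology}, 'e::euclidean_space) chart set \<Rightarrow> bool" where
  "smooth_structure A \<longleftrightarrow>
     (\<forall>c\<in>A. is_chart c) \<and> (\<Union>c\<in>A. fst c) = UNIV \<and>
     (\<forall>c\<in>A. \<forall>c'\<in>A. compatible c c') \<and>
     (\<forall>c. is_chart c \<and> (\<forall>c'\<in>A. compatible c c') \<longrightarrow> c \<in> A)"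

definition smooth_map ::
    "('a::topological_space, 'e::euclidean_space) chart set \<Rightarrow>
     ('b::topological_space, 'f::euclidean_space) chart set \<Rightarrow> ('a \<Rightarrow> 'b) \<Rightarrow> bool" where
  "smooth_map A B f \<longleftrightarrow> continuous_on UNIV f \<and>
     (\<forall>c\<in>A. \<forall>c'\<in>B. smooth_on (snd c ` (fst c \<inter> f -` fst c')) (snd c' \<circ> f \<circ> cinv c))"

definition smooth_curve ::
    "('a::topological_space, 'e::euclidean_space) chart set \<Rightarrow> (real \<Rightarrow> 'a) \<Rightarrow> bool" where
  "smooth_curve A \<gamma> \<longleftrightarrow> continuous_on UNIV \<gamma> \<and> (\<forall>c\<in>A. smooth_on (\<gamma> -` fst c) (snd c \<circ> \<gamma>))"


section \<open>Tangent vectors and tensor fields\<close>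

text \<open>For each point \<open>p\<close> one chart \<open>chart_at A p\<close> around \<open>p\<close> is chosen once and for all, and the
  tangent space at \<open>p\<close> is identified with the model space \<open>'e\<close> through this chart. A tensor at \<open>p\<close> is
  thus a (multi)linear map on \<open>'e\<close>. The chosen chart depends discontinuously on \<open>p\<close>, so
  differential conditions on tensor fields (smoothness, closedness, \<dots>) are always imposed on their
  components in the charts of the smooth structure; these components, obtained with \<open>coord_vec\<close>
  and \<open>coords\<close>, do not depend on the choice.\<close>

definition chart_at :: "('a, 'e) chart set \<Rightarrow> 'a \<Rightarrow> ('a, 'e) chart" where
  "chart_at A p = (SOME c. c \<in> A \<and> p \<in> fst c)"

text \<open>\<open>coord_vec A c p u\<close> is the tangent vector at \<open>p\<close> whose coordinates in the chart \<open>c\<close> are \<open>u\<close>;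
  conversely \<open>coords A c p v\<close> are the coordinates in \<open>c\<close> of the tangent vector \<open>v\<close> at \<open>p\<close>.\<close>

definition coord_vec ::
    "('a, 'e::euclidean_space) chart set \<Rightarrow> ('a, 'e) chart \<Rightarrow> 'a \<Rightarrow> 'e \<Rightarrow> 'e" where
  "coord_vec A c p = frechet_derivative (snd (chart_at A p) \<circ> cinv c) (at (snd c p))"

definition coords ::
    "('a, 'e::euclidean_space) chart set \<Rightarrow> ('a, 'e) chart \<Rightarrow> 'a \<Rightarrow> 'e \<Rightarrow> 'e" where
  "coords A c p = frechet_derivative (snd c \<circ> cinv (chart_at A p)) (at (snd (chart_at A p) p))"

definition mderiv ::
    "('a, 'e::euclidean_space) chart set \<Rightarrow> ('b, 'f::euclidean_space) chart set \<Rightarrow>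
     ('a \<Rightarrow> 'b) \<Rightarrow> 'a \<Rightarrow> 'e \<Rightarrow> 'f" where
  "mderiv A B f p = frechet_derivative (snd (chart_at B (f p)) \<circ> f \<circ> cinv (chart_at A p))
                                       (at (snd (chart_at A p) p))"

definition component2 ::
    "('a, 'e::euclidean_space) chart set \<Rightarrow> ('a \<Rightarrow> 'e \<Rightarrow> 'e \<Rightarrow> 'b) \<Rightarrow> ('a, 'e) chart \<Rightarrow>
     'e \<Rightarrow> 'e \<Rightarrow> 'e \<Rightarrow> 'b" where
  "component2 A \<omega> c x u v =
     (let p = cinv c x in \<omega> p (coord_vec A c p u) (coord_vec A c p v))"

definition smooth_bilinear_field ::
    "('a, 'e::euclidean_space) chart set \<Rightarrow> ('a \<Rightarrow> 'e \<Rightarrow> 'e \<Rightarrow> 'b::real_normed_vector) \<Rightarrow> bool" where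
  "smooth_bilinear_field A \<omega> \<longleftrightarrow> (\<forall>p. bilinear (\<omega> p)) \<and>
     (\<forall>c\<in>A. \<forall>u v. smooth_on (snd c ` fst c) (\<lambda>x. component2 A \<omega> c x u v))"

definition smooth_endo_field ::
    "('a, 'e::euclidean_space) chart set \<Rightarrow> ('a \<Rightarrow> 'e \<Rightarrow> 'e) \<Rightarrow> bool" where
  "smooth_endo_field A J \<longleftrightarrow> (\<forall>p. linear (J p)) \<and>
     (\<forall>c\<in>A. \<forall>u. smooth_on (snd c ` fst c)
        (\<lambda>x. let p = cinv c x in coords A c p (J p (coord_vec A c p u))))"

text \<open>Vanishing of the exterior derivative, evaluated on coordinate (hence commuting) vector fields.\<close>

definition closed_2form ::
    "('a, 'e::euclidean_space) chart set \<Rightarrow> ('a \<Rightarrow> 'e \<Rightarrow> 'e \<Rightarrow> real) \<Rightarrow> bool" where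
  "closed_2form A \<omega> \<longleftrightarrow>
     (\<forall>c\<in>A. \<forall>x\<in>snd c ` fst c. \<forall>u v w.
        frechet_derivative (\<lambda>y. component2 A \<omega> c y v w) (at x) u
      - frechet_derivative (\<lambda>y. component2 A \<omega> c y u w) (at x) v
      + frechet_derivative (\<lambda>y. component2 A \<omega> c y u v) (at x) w = 0)"

definition pullback2 ::
    "('a, 'e::euclidean_space) chart set \<Rightarrow> ('a \<Rightarrow> 'a) \<Rightarrow> ('a \<Rightarrow> 'e \<Rightarrow> 'e \<Rightarrow> 'b) \<Rightarrow>
     'a \<Rightarrow> 'e \<Rightarrow> 'e \<Rightarrow> 'b" where
  "pullback2 A f \<omega> p u v = \<omega> (f p) (mderiv A A f p u) (mderiv A A f p v)"


section \<open>Riemannian metrics and holonomy\<close>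

definition riemannian_metric ::
    "('a, 'e::euclidean_space) chart set \<Rightarrow> ('a \<Rightarrow> 'e \<Rightarrow> 'e \<Rightarrow> real) \<Rightarrow> bool" where
  "riemannian_metric A g \<longleftrightarrow> smooth_bilinear_field A g \<and>
     (\<forall>p u v. g p u v = g p v u) \<and> (\<forall>p u. u \<noteq> 0 \<longrightarrow> g p u u > 0)"

text \<open>\<open>christoffel A g c x u v\<close> is \<open>\<nabla>\<^sub>u v\<close> in the chart \<open>c\<close> at \<open>x\<close>, for the Levi-Civita connection
  and constant \<open>u, v\<close>; it is characterised by the Koszul formula.\<close>

definition christoffel ::
    "('a, 'e::euclidean_space) chart set \<Rightarrow> ('a \<Rightarrow> 'e \<Rightarrow> 'e \<Rightarrow> real) \<Rightarrow> ('a, 'e) chart \<Rightarrow>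
     'e \<Rightarrow> 'e \<Rightarrow> 'e \<Rightarrow> 'e" where
  "christoffel A g c x u v = (THE w. \<forall>z. component2 A g c x w z =
       (frechet_derivative (\<lambda>y. component2 A g c y v z) (at x) u
      + frechet_derivative (\<lambda>y. component2 A g c y u z) (at x) v
      - frechet_derivative (\<lambda>y. component2 A g c y u v) (at x) z) / 2)"

definition parallel_along ::
    "('a, 'e::euclidean_space) chart set \<Rightarrow> ('a \<Rightarrow> 'e \<Rightarrow> 'e \<Rightarrow> real) \<Rightarrow>
     (real \<Rightarrow> 'a) \<Rightarrow> (real \<Rightarrow> 'e) \<Rightarrow> bool" where
  "parallel_along A g \<gamma> V \<longleftrightarrow>
     (\<forall>t\<in>{0..1}. \<forall>c\<in>A. \<gamma> t \<in> fst c \<longrightarrow>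
        ((\<lambda>s. coords A c (\<gamma> s) (V s)) has_vector_derivative
           - christoffel A g c (snd c (\<gamma> t)) (vector_derivative (snd c \<circ> \<gamma>) (at t))
               (coords A c (\<gamma> t) (V t)))
        (at t within {0..1}))"

text \<open>\<open>transport A g p q T\<close>: \<open>T\<close> is parallel transport along some piecewise smooth curve from \<open>p\<close>
  to \<open>q\<close>, that is, along a finite concatenation of smooth curves \<open>\<gamma>|\<^bsub>[0,1]\<^esub>\<close>.\<close>

inductive transport ::
    "('a::topological_space, 'e::euclidean_space) chart set \<Rightarrow> ('a \<Rightarrow> 'e \<Rightarrow> 'e \<Rightarrow> real) \<Rightarrow>
     'a \<Rightarrow> 'a \<Rightarrow> ('e \<Rightarrow> 'e) \<Rightarrow> bool"
  for A g where
  transport_refl: "transport A g p p id"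
| transport_step: "transport A g p q T \<Longrightarrow> smooth_curve A \<gamma> \<Longrightarrow> \<gamma> 0 = q \<Longrightarrow>
     (\<And>v. \<exists>V. parallel_along A g \<gamma> V \<and> V 0 = v \<and> V 1 = T' v) \<Longrightarrow>
     transport A g p (\<gamma> 1) (T' \<circ> T)"

definition holonomy_group ::
    "('a::topological_space, 'e::euclidean_space) chart set \<Rightarrow> ('a \<Rightarrow> 'e \<Rightarrow> 'e \<Rightarrow> real) \<Rightarrow>
     'a \<Rightarrow> ('e \<Rightarrow> 'e) set" where
  "holonomy_group A g p = {T. transport A g p p T}"

text \<open>\<open>is_Sp b G\<close>: with respect to the inner product \<open>b\<close>, the group \<open>G\<close> is \<open>Sp(d)\<close> acting on
  \<open>\<real>\<^bsup>4d\<^esup> = \<bbbH>\<^sup>d\<close> for some isometric identification of \<open>'e\<close> with \<open>\<bbbH>\<^sup>d\<close> (\<open>4d\<close> being the dimension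
  of \<open>'e\<close>). Such an identification amounts to a quaternionic structure \<open>i, j, k\<close> by \<open>b\<close>-isometries,
  and \<open>Sp(d)\<close> consists of the isometries that are linear over the quaternions.\<close>

definition is_Sp :: "('e::euclidean_space \<Rightarrow> 'e \<Rightarrow> real) \<Rightarrow> ('e \<Rightarrow> 'e) set \<Rightarrow> bool" where
  "is_Sp b G \<longleftrightarrow> (\<exists>i j k.
     (\<forall>f\<in>{i, j, k}. linear f \<and> (\<forall>u v. b (f u) (f v) = b u v) \<and> (\<forall>u. f (f u) = - u)) \<and>
     (\<forall>u. i (j u) = k u \<and> j (i u) = - k u) \<and>
     G = {T. linear T \<and> (\<forall>u v. b (T u) (T v) = b u v) \<and>
             T \<circ> i = i \<circ> T \<and> T \<circ> j = j \<circ> T \<and> T \<circ> k = k \<circ> T})"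


section \<open>Complex structures and hyper-Kaehler manifolds\<close>

text \<open>From here on the model space is \<open>\<complex>\<^sup>n\<close>, \<open>n = CARD('n)\<close>, so that the real dimension is \<open>2n\<close>.
  As smooth charts are only required to be compatible over the reals, this does not single out a
  complex structure.

  An almost complex structure is called integrable if around every point there are holomorphic
  coordinates, i.e. if it comes from a holomorphic atlas.\<close>

definition holomorphic_chart ::
    "('a, complex^'n) chart set \<Rightarrow> ('a \<Rightarrow> complex^'n \<Rightarrow> complex^'n) \<Rightarrow>
     ('a, complex^'n) chart \<Rightarrow> bool" where
  "holomorphic_chart A J c \<longleftrightarrow>
     c \<in> A \<and> (\<forall>p\<in>fst c. \<forall>u. coords A c p (J p u) = \<i> *s coords A c p u)"

definition complex_structure ::
    "('a, complex^'n) chart set \<Rightarrow> ('a \<Rightarrow> complex^'n \<Rightarrow> complex^'n) \<Rightarrow> bool" where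
  "complex_structure A J \<longleftrightarrow> smooth_endo_field A J \<and> (\<forall>p u. J p (J p u) = - u) \<and>
     (\<forall>p. \<exists>c. holomorphic_chart A J c \<and> p \<in> fst c)"

definition hermitian_form :: "('a \<Rightarrow> 'e \<Rightarrow> 'e \<Rightarrow> real) \<Rightarrow> ('a \<Rightarrow> 'e \<Rightarrow> 'e) \<Rightarrow> 'a \<Rightarrow> 'e \<Rightarrow> 'e \<Rightarrow> real" where
  "hermitian_form g J p u v = g p (J p u) v"

definition kaehler ::
    "('a, complex^'n) chart set \<Rightarrow> ('a \<Rightarrow> complex^'n \<Rightarrow> complex^'n \<Rightarrow> real) \<Rightarrow>
     ('a \<Rightarrow> complex^'n \<Rightarrow> complex^'n) \<Rightarrow> bool" where
  "kaehler A g J \<longleftrightarrow> riemannian_metric A g \<and> complex_structure A J \<and>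
     (\<forall>p u v. g p (J p u) (J p v) = g p u v) \<and> closed_2form A (hermitian_form g J)"

definition hyperkaehler ::
    "('a::{t2_space,second_countable_topology}, complex^'n) chart set \<Rightarrow>
     ('a \<Rightarrow> complex^'n \<Rightarrow> complex^'n \<Rightarrow> real) \<Rightarrow> ('a \<Rightarrow> complex^'n \<Rightarrow> complex^'n) \<Rightarrow>
     ('a \<Rightarrow> complex^'n \<Rightarrow> complex^'n) \<Rightarrow> ('a \<Rightarrow> complex^'n \<Rightarrow> complex^'n) \<Rightarrow> bool" where
  "hyperkaehler A g I J K \<longleftrightarrow>
     smooth_structure A \<and> connected (UNIV :: 'a set) \<and>
     kaehler A g I \<and> kaehler A g J \<and> kaehler A g K \<and>
     (\<forall>p u. K p u = I p (J p u) \<and> K p u = - J p (I p u) \<and>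
            J p u = - I p (K p u) \<and> J p u = K p (I p u) \<and>
            I p u = J p (K p u) \<and> I p u = - K p (J p u))"

definition irreducible_hyperkaehler ::
    "('a::{t2_space,second_countable_topology}, complex^'n) chart set \<Rightarrow>
     ('a \<Rightarrow> complex^'n \<Rightarrow> complex^'n \<Rightarrow> real) \<Rightarrow> ('a \<Rightarrow> complex^'n \<Rightarrow> complex^'n) \<Rightarrow>
     ('a \<Rightarrow> complex^'n \<Rightarrow> complex^'n) \<Rightarrow> ('a \<Rightarrow> complex^'n \<Rightarrow> complex^'n) \<Rightarrow> bool" where
  "irreducible_hyperkaehler A g I J K \<longleftrightarrow>
     hyperkaehler A g I J K \<and> (\<forall>p. is_Sp (g p) (holonomy_group A g p))"

text \<open>Holomorphic \<open>2\<close>-forms: of type \<open>(2,0)\<close>, with holomorphic coefficients in holomorphic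
  coordinates. For a form of type \<open>(2,0)\<close> the coefficient of \<open>dz\<^sub>a \<and> dz\<^sub>b\<close> is its value on the real
  coordinate vectors \<open>\<partial>/\<partial>x\<^sub>a\<close>, \<open>\<partial>/\<partial>x\<^sub>b\<close>.\<close>

definition holomorphic_fun_on :: "(complex^'n) set \<Rightarrow> (complex^'n \<Rightarrow> complex) \<Rightarrow> bool" where
  "holomorphic_fun_on S h \<longleftrightarrow>
     (\<forall>x\<in>S. \<exists>D. (h has_derivative D) (at x) \<and> (\<forall>w. D (\<i> *s w) = \<i> * D w))"

definition holomorphic_2form ::
    "('a, complex^'n) chart set \<Rightarrow> ('a \<Rightarrow> complex^'n \<Rightarrow> complex^'n) \<Rightarrow>
     ('a \<Rightarrow> complex^'n \<Rightarrow> complex^'n \<Rightarrow> complex) \<Rightarrow> bool" where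
  "holomorphic_2form A I \<theta> \<longleftrightarrow>
     smooth_bilinear_field A \<theta> \<and> (\<forall>p u v. \<theta> p u v = - \<theta> p v u) \<and>
     (\<forall>p u v. \<theta> p (I p u) v = \<i> * \<theta> p u v) \<and>
     (\<forall>c. holomorphic_chart A I c \<longrightarrow>
        (\<forall>a b. holomorphic_fun_on (snd c ` fst c)
                 (\<lambda>x. component2 A \<theta> c x (axis a 1) (axis b 1))))"

text \<open>Norm of a complex \<open>2\<close>-form at a point, for the inner product \<open>b\<close>; the value does not depend
  on the chosen orthonormal frame.\<close>

definition orthonormal_frame ::
    "('e::euclidean_space \<Rightarrow> 'e \<Rightarrow> real) \<Rightarrow> (nat \<Rightarrow> 'e) \<Rightarrow> bool" where
  "orthonormal_frame b e \<longleftrightarrow>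
     (\<forall>i<DIM('e). \<forall>j<DIM('e). b (e i) (e j) = (if i = j then 1 else 0))"

definition form2_norm ::
    "('e::euclidean_space \<Rightarrow> 'e \<Rightarrow> real) \<Rightarrow> ('e \<Rightarrow> 'e \<Rightarrow> complex) \<Rightarrow> real" where
  "form2_norm b \<theta> = (let e = (SOME e. orthonormal_frame b e) in
     sqrt (\<Sum>j<DIM('e). \<Sum>i<j. (cmod (\<theta> (e i) (e j)))\<^sup>2))"


section \<open>Exterior powers\<close>

text \<open>A \<open>k\<close>-form on \<open>'e\<close> is a function of the first \<open>k\<close> entries of a sequence of vectors.\<close>

definition wedge ::
    "nat \<Rightarrow> nat \<Rightarrow> ((nat \<Rightarrow> 'e) \<Rightarrow> complex) \<Rightarrow> ((nat \<Rightarrow> 'e) \<Rightarrow> complex) \<Rightarrow> (nat \<Rightarrow> 'e) \<Rightarrow> complex" where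
  "wedge k l \<alpha> \<beta> v =
     (\<Sum>\<pi> | \<pi> permutes {..<k + l}.
        of_int (sign \<pi>) * \<alpha> (\<lambda>i. v (\<pi> i)) * \<beta> (\<lambda>i. v (\<pi> (k + i)))) / (fact k * fact l)"

primrec wedge_power :: "('e \<Rightarrow> 'e \<Rightarrow> complex) \<Rightarrow> nat \<Rightarrow> (nat \<Rightarrow> 'e) \<Rightarrow> complex" where
  "wedge_power \<theta> 0 = (\<lambda>v. 1)"
| "wedge_power \<theta> (Suc n) = wedge 2 (2 * n) (\<lambda>v. \<theta> (v 0) (v 1)) (wedge_power \<theta> n)"


section \<open>Submanifolds\<close>

definition slice_chart ::
    "('a, 'e::euclidean_space) chart set \<Rightarrow> 'a set \<Rightarrow> ('a, 'e) chart \<Rightarrow> 'e set \<Rightarrow> bool" where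
  "slice_chart A S c V \<longleftrightarrow> c \<in> A \<and> subspace V \<and> snd c ` (fst c \<inter> S) = snd c ` fst c \<inter> V"

definition submanifold ::
    "('a, 'e::euclidean_space) chart set \<Rightarrow> nat \<Rightarrow> 'a set \<Rightarrow> bool" where
  "submanifold A k S \<longleftrightarrow> (\<forall>p\<in>S. \<exists>c V. slice_chart A S c V \<and> p \<in> fst c \<and> dim V = k)"

text \<open>The image of the tangent space of \<open>S\<close> under the differential of the inclusion.\<close>

definition tangent_of ::
    "('a, 'e::euclidean_space) chart set \<Rightarrow> 'a set \<Rightarrow> 'a \<Rightarrow> 'e set" where
  "tangent_of A S p = {u. \<exists>c V. slice_chart A S c V \<and> p \<in> fst c \<and> coords A c p u \<in> V}"

definition special_lagrangian ::
    "('a, 'e::euclidean_space) chart set \<Rightarrow> nat \<Rightarrow> ('a \<Rightarrow> 'e \<Rightarrow> 'e \<Rightarrow> real) \<Rightarrow>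
     ('a \<Rightarrow> (nat \<Rightarrow> 'e) \<Rightarrow> complex) \<Rightarrow> 'a set \<Rightarrow> bool" where
  "special_lagrangian A d \<omega> \<Theta> S \<longleftrightarrow> submanifold A (2 * d) S \<and>
     (\<forall>p\<in>S. \<forall>u\<in>tangent_of A S p. \<forall>v\<in>tangent_of A S p. \<omega> p u v = 0) \<and>
     (\<forall>p\<in>S. \<forall>v. (\<forall>i<2 * d. v i \<in> tangent_of A S p) \<longrightarrow> Im (\<Theta> p v) = 0)"

definition complex_submanifold ::
    "('a, complex^'n) chart set \<Rightarrow> ('a \<Rightarrow> complex^'n \<Rightarrow> complex^'n) \<Rightarrow> nat \<Rightarrow> 'a set \<Rightarrow> bool" where
  "complex_submanifold A J k S \<longleftrightarrow>
     (\<forall>p\<in>S. \<exists>c V. holomorphic_chart A J c \<and> slice_chart A S c V \<and> p \<in> fst c \<and>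
                  vec.subspace V \<and> vec.dim V = k)"

definition complex_lagrangian ::
    "('a, complex^'n) chart set \<Rightarrow> nat \<Rightarrow> ('a \<Rightarrow> complex^'n \<Rightarrow> complex^'n) \<Rightarrow>
     ('a \<Rightarrow> complex^'n \<Rightarrow> complex^'n \<Rightarrow> complex) \<Rightarrow> 'a set \<Rightarrow> bool" where
  "complex_lagrangian A d J \<theta> S \<longleftrightarrow> complex_submanifold A J d S \<and>
     (\<forall>p\<in>S. \<forall>u\<in>tangent_of A S p. \<forall>v\<in>tangent_of A S p. \<theta> p u v = 0)"

end

theory Submission
  imports Defs
begin

text \<open>On the fixed locus \<open>S\<close> all the vanishing statements are pointwise. A vector tangent to \<open>S\<close> is fixed by
  \<open>d\<sigma>\<close> (\<open>tangent_of_fixed_points\<close>). Since \<open>\<sigma>\<close> changes the sign of \<open>\<omega>\<^sub>I\<close>, and of \<open>\<omega>\<^sub>K = Im \<theta>\<close> because it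
  conjugates \<open>\<theta>\<close>, both forms vanish on such vectors. Therefore \<open>\<theta>\<^sub>J = \<omega>\<^sub>K + \<i> \<omega>\<^sub>I\<close> vanishes there, while
  \<open>\<theta>\<close> and \<open>\<theta>\<^sub>K = \<omega>\<^sub>J + \<i> \<omega>\<^sub>I\<close> are real there, and with them their exterior powers
  (\<open>wedge_power_real\<close>).

  It remains to see that \<open>S\<close> is a submanifold of real dimension \<open>2d\<close> and a complex submanifold for
  \<open>J\<close> of complex dimension \<open>d\<close>. The involution reverses \<open>I\<close> and \<open>\<omega>\<^sub>I\<close>, so it is an isometry; as it
  preserves \<open>Re \<theta> = g(J \<cdot>, \<cdot>)\<close>, it is holomorphic for \<open>J\<close>. Around a fixed point, start with a
  \<open>J\<close>-holomorphic chart and average it with its transform under \<open>\<sigma>\<close>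
  (\<open>involution_linearizing_chart\<close>): the resulting chart is again \<open>J\<close>-holomorphic, and \<open>\<sigma>\<close> becomes
  in it a complex linear involution \<open>L\<close>, whose fixed space is the local model of \<open>S\<close>. One chart thus serves
  for both the real and the complex claim. The structure \<open>I\<close> anticommutes with \<open>d\<sigma>\<close>, so it exchanges
  the eigenspaces for \<open>1\<close> and \<open>-1\<close>, and the fixed space has half the dimension of \<open>X\<close>
  (\<open>dim_fixed_space_of_involution\<close>, \<open>dim_eq_twice_complex_dim\<close>).

  The averaged chart belongs to the maximal atlas because it is smooth with smooth inverse. This
  is where the calculus of \<^const>\<open>smooth_on\<close> is needed: closure under composition, and an inverse
  function theorem with a smooth inverse (\<open>smooth_local_inverse\<close>).\<close>

section \<open>Calculus of smooth maps\<close>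

lemma Ck_on_subset: "Ck_on k S f \<Longrightarrow> T \<subseteq> S \<Longrightarrow> Ck_on k T f"
  by (induction k arbitrary: f) (auto intro: continuous_on_subset)

lemma Ck_on_cong:
  assumes "open S" "\<And>x. x \<in> S \<Longrightarrow> f x = g x" "Ck_on k S f"
  shows "Ck_on k S g"
  using assms(2,3)
proof (induction k arbitrary: f g)
  case 0
  then show ?case by (simp cong: continuous_on_cong)
next
  case (Suc k)
  have D: "(g has_derivative frechet_derivative f (at x)) (at x)" if "x \<in> S" for x
    by (rule has_derivative_transform_within_open[OF _ assms(1) that, of f])
       (use Suc.prems that in \<open>auto simp: frechet_derivative_works[symmetric]\<close>)
  have "Ck_on k S (\<lambda>x. frechet_derivative g (at x) v)" for v
  proof (rule Suc.IH)
    show "frechet_derivative f (at x) v = frechet_derivative g (at x) v" if "x \<in> S" for x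
      using frechet_derivative_at[OF D[OF that]] by simp
    show "Ck_on k S (\<lambda>x. frechet_derivative f (at x) v)" using Suc.prems by simp
  qed
  then show ?case using D by (auto simp: differentiable_def)
qed

text \<open>Sums, products and compositions are treated by induction on the order of differentiability with
  this rule: a derivative computed by hand may replace \<^const>\<open>frechet_derivative\<close>, and the induction
  hypothesis is applied to the formula for it.\<close>

lemma Ck_on_SucI:
  assumes "open S" "\<And>x. x \<in> S \<Longrightarrow> (f has_derivative f' x) (at x)"
    "\<And>v. Ck_on k S (\<lambda>x. f' x v)"
  shows "Ck_on (Suc k) S f"
proof -
  have "Ck_on k S (\<lambda>x. frechet_derivative f (at x) v)" for v
    by (rule Ck_on_cong[OF assms(1) _ assms(3)[of v]])
       (simp add: frechet_derivative_at[OF assms(2)])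
  then show ?thesis using assms(2) by (auto simp: differentiable_def)
qed

lemma Ck_on_has_derivative:
  "Ck_on (Suc k) S f \<Longrightarrow> x \<in> S \<Longrightarrow> (f has_derivative frechet_derivative f (at x)) (at x)"
  by (simp add: frechet_derivative_works[symmetric])

lemma Ck_on_pred: "Ck_on (Suc k) S f \<Longrightarrow> Ck_on k S f"
proof (induction k arbitrary: f)
  case 0
  then show ?case
    by (auto intro!: differentiable_imp_continuous_on
        simp: differentiable_on_def differentiable_at_withinI)
next
  case (Suc k)
  then show ?case by (metis Ck_on.simps(2))
qed

lemma smooth_onD: "smooth_on S f \<Longrightarrow> Ck_on k S f"
  by (simp add: smooth_on_def)

lemma smooth_on_subset: "smooth_on S f \<Longrightarrow> T \<subseteq> S \<Longrightarrow> smooth_on T f"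
  unfolding smooth_on_def using Ck_on_subset by blast

lemma smooth_on_cong:
  "open S \<Longrightarrow> (\<And>x. x \<in> S \<Longrightarrow> f x = g x) \<Longrightarrow> smooth_on S f \<Longrightarrow> smooth_on S g"
  unfolding smooth_on_def using Ck_on_cong by blast

lemma smooth_on_has_derivative:
  "smooth_on S f \<Longrightarrow> x \<in> S \<Longrightarrow> (f has_derivative frechet_derivative f (at x)) (at x)"
  using Ck_on_has_derivative smooth_onD by blast

lemma smooth_on_continuous: "smooth_on S f \<Longrightarrow> continuous_on S f"
  using smooth_onD[of S f 0] by simp

lemma smooth_on_derivative:
  "smooth_on S f \<Longrightarrow> smooth_on S (\<lambda>x. frechet_derivative f (at x) v)"
  unfolding smooth_on_def by (metis Ck_on.simps(2))

lemma Ck_on_const: "Ck_on k S (\<lambda>x. c)"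
  by (induction k arbitrary: c) (auto simp: frechet_derivative_const)

lemma Ck_on_bounded_linear:
  assumes "bounded_linear h" "open S" "Ck_on k S f"
  shows "Ck_on k S (\<lambda>x. h (f x))"
  using assms(3)
proof (induction k arbitrary: f)
  case 0
  then show ?case using assms(1) by (simp add: bounded_linear.continuous_on)
next
  case (Suc k)
  show ?case
    by (rule Ck_on_SucI[OF assms(2) bounded_linear.has_derivative[OF assms(1)
        Ck_on_has_derivative[OF Suc.prems]]]) (use Suc in auto)
qed

lemma Ck_on_add:
  assumes "open S" "Ck_on k S f" "Ck_on k S g"
  shows "Ck_on k S (\<lambda>x. f x + g x)"
  using assms(2,3)
proof (induction k arbitrary: f g)
  case 0
  then show ?case by (simp add: continuous_on_add)
next
  case (Suc k)
  show ?case
    by (rule Ck_on_SucI[OF assms(1) has_derivative_add[OF Ck_on_has_derivative[OF Suc.prems(1)]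
        Ck_on_has_derivative[OF Suc.prems(2)]]]) (use Suc in auto)
qed

lemma Ck_on_sum:
  assumes "open S" "\<And>i. i \<in> B \<Longrightarrow> Ck_on k S (f i)"
  shows "Ck_on k S (\<lambda>x. \<Sum>i\<in>B. f i x)"
  using assms(2)
  by (induction B rule: infinite_finite_induct) (auto intro: Ck_on_const Ck_on_add assms(1))

lemma Ck_on_bilinear:
  assumes bil: "bounded_bilinear h" and "open S" "Ck_on k S f" "Ck_on k S g"
  shows "Ck_on k S (\<lambda>x. h (f x) (g x))"
  using assms(3,4)
proof (induction k arbitrary: f g)
  case 0
  then show ?case using bil by (simp add: bounded_bilinear.continuous_on)
next
  case (Suc k)
  show ?case
    by (rule Ck_on_SucI[OF \<open>open S\<close> bounded_bilinear.FDERIV[OF bil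
        Ck_on_has_derivative[OF Suc.prems(1)] Ck_on_has_derivative[OF Suc.prems(2)]]])
      (use Suc.prems in \<open>auto intro!: Ck_on_add Suc.IH \<open>open S\<close> simp del: Ck_on.simps
        simp: Ck_on_pred Ck_on.simps(2)[THEN iffD1]\<close>)
qed

lemma linear_basis_expand:
  fixes L :: "'a::euclidean_space \<Rightarrow> 'b::real_vector"
  assumes "linear L"
  shows "L v = (\<Sum>b\<in>Basis. (v \<bullet> b) *\<^sub>R L b)"
proof -
  have "L v = L (\<Sum>b\<in>Basis. (v \<bullet> b) *\<^sub>R b)" by (simp add: euclidean_representation)
  also have "\<dots> = (\<Sum>b\<in>Basis. (v \<bullet> b) *\<^sub>R L b)"
    using assms by (simp add: linear_sum linear_scale)
  finally show ?thesis .
qed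

text \<open>The recursion in \<^const>\<open>Ck_on\<close> controls a derivative only along fixed directions, while the
  derivative of a composition is taken along a moving one. In finite dimension the moving direction
  is expanded in a basis, which reduces the claim to products with scalars.\<close>

lemma Ck_on_apply:
  fixes L :: "'c::real_normed_vector \<Rightarrow> 'a::euclidean_space \<Rightarrow> 'b::real_normed_vector"
  assumes "open S" "\<And>x. x \<in> S \<Longrightarrow> linear (L x)" "\<And>v. Ck_on k S (\<lambda>x. L x v)" "Ck_on k S w"
  shows "Ck_on k S (\<lambda>x. L x (w x))"
proof (rule Ck_on_cong[OF assms(1)])
  show "Ck_on k S (\<lambda>x. \<Sum>b\<in>Basis. (w x \<bullet> b) *\<^sub>R L x b)"
    by (intro Ck_on_sum Ck_on_bilinear[OF bounded_bilinear_scaleR] assms(1,3)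
        Ck_on_bounded_linear[OF bounded_linear_inner_left] assms(4))
qed (use linear_basis_expand[OF assms(2)] in simp)

lemma Ck_on_compose:
  fixes f :: "'a::real_normed_vector \<Rightarrow> 'b::euclidean_space" and g :: "'b \<Rightarrow> 'c::real_normed_vector"
  assumes "open S" "open T" "f ` S \<subseteq> T" "Ck_on k S f" "Ck_on k T g"
  shows "Ck_on k S (g \<circ> f)"
  using assms(4,5)
proof (induction k arbitrary: g)
  case 0
  then show ?case
    by (metis Ck_on.simps(1) assms(3) continuous_on_compose continuous_on_subset)
next
  case (Suc k)
  have D: "(g \<circ> f has_derivative (frechet_derivative g (at (f x)) \<circ> frechet_derivative f (at x))) (at x)"
    if "x \<in> S" for x
    using that assms(3)
    by (intro diff_chain_at Ck_on_has_derivative[OF Suc.prems(1)] Ck_on_has_derivative[OF Suc.prems(2)]) auto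
  show ?case
  proof (rule Ck_on_SucI[OF assms(1) D])
    fix v
    have "Ck_on k S (\<lambda>x. frechet_derivative g (at (f x)) (frechet_derivative f (at x) v))"
    proof (rule Ck_on_apply[OF assms(1)])
      show "linear (frechet_derivative g (at (f x)))" if "x \<in> S" for x
        using Suc.prems(2) assms(3) that by (auto intro!: linear_frechet_derivative)
      show "Ck_on k S (\<lambda>x. frechet_derivative g (at (f x)) w)" for w
        using Suc.IH[OF Ck_on_pred[OF Suc.prems(1)], of "\<lambda>y. frechet_derivative g (at y) w"] Suc.prems(2)
        by (auto simp: o_def)
      show "Ck_on k S (\<lambda>x. frechet_derivative f (at x) v)" using Suc.prems(1) by simp
    qed
    then show "Ck_on k S (\<lambda>x. (frechet_derivative g (at (f x)) \<circ> frechet_derivative f (at x)) v)"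
      by simp
  qed
qed

lemma smooth_on_compose:
  fixes f :: "'a::real_normed_vector \<Rightarrow> 'b::euclidean_space" and g :: "'b \<Rightarrow> 'c::real_normed_vector"
  assumes "open S" "open T" "f ` S \<subseteq> T" "smooth_on S f" "smooth_on T g"
  shows "smooth_on S (g \<circ> f)"
  using assms unfolding smooth_on_def by (blast intro: Ck_on_compose)

lemma smooth_on_add: "open S \<Longrightarrow> smooth_on S f \<Longrightarrow> smooth_on S g \<Longrightarrow> smooth_on S (\<lambda>x. f x + g x)"
  unfolding smooth_on_def by (blast intro: Ck_on_add)

lemma smooth_on_bounded_linear:
  "bounded_linear h \<Longrightarrow> open S \<Longrightarrow> smooth_on S f \<Longrightarrow> smooth_on S (\<lambda>x. h (f x))"
  unfolding smooth_on_def by (blast intro: Ck_on_bounded_linear)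

lemma smooth_on_const: "smooth_on S (\<lambda>x. c)"
  unfolding smooth_on_def by (blast intro: Ck_on_const)

lemma smooth_on_id: "open S \<Longrightarrow> smooth_on S (\<lambda>x. x)"
  unfolding smooth_on_def
proof
  fix k assume S: "open S"
  show "Ck_on k S (\<lambda>x. x)"
  proof (cases k)
    case (Suc m)
    show ?thesis unfolding Suc
      by (rule Ck_on_SucI[OF S has_derivative_ident]) (rule Ck_on_const)
  qed simp
qed

section \<open>The smooth inverse function theorem\<close>

text \<open>The product rule for a factor \<open>q\<close> that is merely continuous: it survives at a zero of \<open>p\<close>, since
  the term \<open>p a \<cdot> q'\<close> is then absent.\<close>

lemma has_derivative_scaleR_at_zero:
  fixes p :: "'a::real_normed_vector \<Rightarrow> real" and q :: "'a \<Rightarrow> 'b::real_normed_vector"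
  assumes "(p has_derivative p') (at a)" "p a = 0" "isCont q a"
  shows "((\<lambda>x. p x *\<^sub>R q x) has_derivative (\<lambda>h. p' h *\<^sub>R q a)) (at a)"
proof -
  have "((\<lambda>x. p x *\<^sub>R q a) has_derivative (\<lambda>h. p' h *\<^sub>R q a)) (at a)"
    using assms(1) by (rule has_derivative_scaleR_left)
  moreover have "((\<lambda>x. p x *\<^sub>R (q x - q a)) has_derivative (\<lambda>h. 0)) (at a)"
  proof -
    from has_derivative_at[of p p' a] assms(1)
    have bl: "bounded_linear p'" by (simp add: has_derivative_bounded_linear)
    obtain K where K: "K > 0" "\<And>x. \<bar>p' x\<bar> \<le> norm x * K"
      using bounded_linear.pos_bounded[OF bl] by auto
    have lim: "((\<lambda>h. norm (p (a + h) - p a - p' h) / norm h) \<longlongrightarrow> 0) (at 0)"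
      using assms(1) by (simp add: has_derivative_at)
    have ev: "\<forall>\<^sub>F h in at 0. norm (p (a + h) - p a - p' h) / norm h < 1"
      using order_tendstoD(2)[OF lim, of 1] by simp
    have bnd: "\<forall>\<^sub>F h in at 0. norm (norm (p (a + h) *\<^sub>R (q (a + h) - q a)) / norm h)
        \<le> (1 + K) * norm (q (a + h) - q a)"
      using ev eventually_at_ball[of 1 "0::'a" UNIV, simplified]
    proof (rule eventually_elim2)
      fix h assume h: "norm (p (a + h) - p a - p' h) / norm h < 1"
      show "norm (norm (p (a + h) *\<^sub>R (q (a + h) - q a)) / norm h)
          \<le> (1 + K) * norm (q (a + h) - q a)"
      proof (cases "h = 0")
        case False
        then have "\<bar>p (a + h) - p' h\<bar> \<le> norm h" using h assms(2) by (simp add: field_simps)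
        then have "\<bar>p (a + h)\<bar> \<le> (1 + K) * norm h"
          using K(2)[of h] by (simp add: algebra_simps)
        then have "\<bar>p (a + h)\<bar> * norm (q (a + h) - q a) \<le> ((1 + K) * norm h) * norm (q (a + h) - q a)"
          by (rule mult_right_mono) simp
        then have "\<bar>p (a + h)\<bar> * norm (q (a + h) - q a) / norm h
            \<le> ((1 + K) * norm h) * norm (q (a + h) - q a) / norm h"
          by (rule divide_right_mono) simp
        then show ?thesis using False by simp
      qed (use K in simp)
    qed
    have "((\<lambda>h. (1 + K) * norm (q (a + h) - q a)) \<longlongrightarrow> (1 + K) * norm (q a - q a)) (at 0)"
      using assms(3) by (intro tendsto_intros) (simp add: isCont_iff)
    then have "((\<lambda>h. norm (p (a + h) *\<^sub>R (q (a + h) - q a)) / norm h) \<longlongrightarrow> 0) (at 0)"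
      by (intro Lim_null_comparison[OF bnd]) simp
    then show ?thesis using assms(2) by (simp add: has_derivative_at)
  qed
  ultimately show ?thesis
    using has_derivative_add[of "\<lambda>x. p x *\<^sub>R q a" "\<lambda>h. p' h *\<^sub>R q a" "at a" "\<lambda>x. p x *\<^sub>R (q x - q a)" "\<lambda>h. 0"]
    by (simp add: algebra_simps)
qed

text \<open>Near \<open>y0\<close> the maps \<open>L y\<close> are bounded below by a common constant, so \<open>M y\<close> is uniformly bounded and
  \<open>M y v - M y0 v = M y (L y0 - L y) (M y0 v)\<close> tends to \<open>0\<close>.\<close>

lemma isCont_inverse_family:
  fixes L M :: "'c::metric_space \<Rightarrow> 'a::euclidean_space \<Rightarrow> 'a"
  assumes "open T" "y0 \<in> T"
    and lin: "\<And>y. y \<in> T \<Longrightarrow> linear (L y)"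
    and L_M: "\<And>y v. y \<in> T \<Longrightarrow> L y (M y v) = v" and M_L: "\<And>y v. y \<in> T \<Longrightarrow> M y (L y v) = v"
    and cont: "\<And>v. isCont (\<lambda>y. L y v) y0"
  shows "isCont (\<lambda>y. M y v) y0"
proof -
  have "inj (L y0)" using M_L assms(2) by (metis injI)
  then obtain c where c: "c > 0" "\<And>u. c * norm u \<le> norm (L y0 u)"
    using linear_inj_bounded_below_pos[OF lin[OF assms(2)]] by blast
  \<comment> \<open>An upper bound for the operator norm of \<open>L y - L y0\<close> that only involves fixed vectors.\<close>
  define s where "s y = (\<Sum>b\<in>Basis. norm (L y b - L y0 b))" for y
  have "(s \<longlongrightarrow> (\<Sum>b\<in>(Basis::'a set). norm (L y0 b - L y0 b))) (at y0)"
    unfolding s_def using cont by (intro tendsto_intros) (auto simp: isCont_def)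
  then have s0: "(s \<longlongrightarrow> 0) (at y0)" by simp
  have diff: "norm (L y u - L y0 u) \<le> norm u * s y" if "y \<in> T" for y u
  proof -
    have "L y u - L y0 u = (\<Sum>b\<in>Basis. (u \<bullet> b) *\<^sub>R (L y b - L y0 b))"
      by (simp add: linear_basis_expand[OF lin[OF that], of u]
          linear_basis_expand[OF lin[OF assms(2)], of u] sum_subtractf scaleR_diff_right)
    also have "norm \<dots> \<le> (\<Sum>b\<in>Basis. norm u * norm (L y b - L y0 b))"
      by (rule sum_norm_le) (auto intro!: mult_right_mono simp: Basis_le_norm)
    finally show ?thesis by (simp add: s_def sum_distrib_left)
  qed
  have evT: "\<forall>\<^sub>F y in at y0. y \<in> T" using assms(1,2) by (rule eventually_at_in_open')
  have "\<forall>\<^sub>F y in at y0. s y < c / 2"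
    using order_tendstoD(2)[OF s0, of "c/2"] c by simp
  then have bound: "\<forall>\<^sub>F y in at y0. norm (M y v - M y0 v) \<le> 2 / c * norm (L y0 (M y0 v) - L y (M y0 v))"
    using evT
  proof eventually_elim
    case (elim y)
    define u where "u = M y v - M y0 v"
    have "norm (L y u - L y0 u) \<le> norm u * (c / 2)"
      using diff[OF elim(2), of u] mult_left_mono[of "s y" "c/2" "norm u"] elim(1) by simp
    then have "c * norm u \<le> norm (L y u) + norm u * (c/2)"
      using c(2)[of u] norm_triangle_ineq3[of "L y u" "L y0 u"] by linarith
    then have "norm u \<le> 2 / c * norm (L y u)" using c(1) by (simp add: field_simps)
    moreover have "L y u = L y0 (M y0 v) - L y (M y0 v)"
      by (simp add: u_def linear_diff[OF lin[OF elim(2)]] L_M elim assms(2))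
    ultimately show ?case by (simp add: u_def)
  qed
  have "((\<lambda>y. 2 / c * norm (L y0 (M y0 v) - L y (M y0 v))) \<longlongrightarrow>
      2 / c * norm (L y0 (M y0 v) - L y0 (M y0 v))) (at y0)"
    using cont[of "M y0 v"] by (intro tendsto_intros) (auto simp: isCont_def)
  then have "((\<lambda>y. M y v - M y0 v) \<longlongrightarrow> 0) (at y0)"
    by (intro Lim_null_comparison[OF bound]) simp
  then show ?thesis by (simp add: isCont_def LIM_zero_iff)
qed

text \<open>With \<open>L y = Df(g y)\<close> and \<open>M y = (L y)\<^sup>-\<^sup>1 = Dg(y)\<close>, the formula for the derivative of an inverse
  operator is \<open>D(M v) w = - M (D\<^sup>2f(M w, M v))\<close>. Its right-hand side is built from \<open>M\<close>, \<open>g\<close> and the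
  smooth map \<open>f\<close>, so if \<open>M\<close> is \<open>C\<^sup>k\<close>, then so is \<open>g\<close> and hence \<open>M\<close> is even \<open>C\<^sup>k\<^sup>+\<^sup>1\<close>.\<close>

lemma smooth_on_inverse:
  fixes f g :: "'a::euclidean_space \<Rightarrow> 'a"
  assumes "open U" "open V" and hom: "homeomorphism U V f g" and f: "smooth_on U f"
    and inj: "\<And>x. x \<in> U \<Longrightarrow> inj (frechet_derivative f (at x))"
  shows "smooth_on V g"
proof -
  define L where "L y = frechet_derivative f (at (g y))" for y
  define M where "M y = inv (L y)" for y
  have gU: "g y \<in> U" and fg: "f (g y) = y" if "y \<in> V" for y
    using hom that by (auto simp: homeomorphism_def)
  have gf: "g (f x) = x" if "x \<in> U" for x
    using hom that by (auto simp: homeomorphism_def)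
  have linL: "linear (L y)" if "y \<in> V" for y
    unfolding L_def using smooth_on_has_derivative[OF f gU[OF that]] has_derivative_linear by blast
  have bijL: "bij (L y)" if "y \<in> V" for y
    using linL[OF that] inj[OF gU[OF that]] linear_inj_imp_surj unfolding L_def bij_def by blast
  have L_M: "L y (M y v) = v" and M_L: "M y (L y v) = v" if "y \<in> V" for y v
    using bijL[OF that] by (simp_all add: M_def surj_f_inv_f bij_is_surj bij_is_inj)
  have linM: "linear (M y)" if "y \<in> V" for y
  proof (rule linearI)
    show "M y (a + b) = M y a + M y b" for a b
      using M_L[OF that, of "M y a + M y b"] linear_add[OF linL[OF that], of "M y a" "M y b"]
      by (simp add: L_M that)
    show "M y (s *\<^sub>R a) = s *\<^sub>R M y a" for s a
      using M_L[OF that, of "s *\<^sub>R M y a"] linear_scale[OF linL[OF that], of s "M y a"]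
      by (simp add: L_M that)
  qed
  have dg: "(g has_derivative M y) (at y)" if "y \<in> V" for y
  proof -
    have "(g has_derivative M y) (at (f (g y)))"
      by (rule has_derivative_inverse_strong[OF \<open>open U\<close> gU[OF that] smooth_on_continuous[OF f] gf])
        (use smooth_on_has_derivative[OF f gU[OF that]] L_M[OF that] in \<open>auto simp: L_def\<close>)
    then show ?thesis using fg[OF that] by simp
  qed
  have dL: "((\<lambda>z. L z u) has_derivative
      (\<lambda>w. frechet_derivative (\<lambda>x. frechet_derivative f (at x) u) (at (g y)) (M y w))) (at y)"
    if "y \<in> V" for y u
    using diff_chain_at[OF dg[OF that] smooth_on_has_derivative[OF smooth_on_derivative[OF f, of u] gU[OF that]]]
    by (simp add: o_def L_def)
  have contM: "isCont (\<lambda>y. M y v) y0" if "y0 \<in> V" for v y0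
    by (rule isCont_inverse_family[where L=L and T=V])
      (use \<open>open V\<close> that linL L_M M_L has_derivative_continuous[OF dL] in auto)
  define Q where "Q y v w = - M y (frechet_derivative (\<lambda>x. frechet_derivative f (at x) (M y v)) (at (g y)) (M y w))"
    for y v w
  have dM: "((\<lambda>z. M z v) has_derivative Q y v) (at y)" if "y \<in> V" for y v
  proof -
    define u where "u = M y v"
    \<comment> \<open>\<open>M z v = u + M z (r z)\<close> with \<open>r y = 0\<close>, so continuity of \<open>M\<close> at \<open>y\<close> is enough to differentiate.\<close>
    define r where "r z = v - L z u" for z
    define r' where "r' w = - frechet_derivative (\<lambda>x. frechet_derivative f (at x) u) (at (g y)) (M y w)" for w
    have r: "(r has_derivative r') (at y)"
      unfolding r_def r'_def using has_derivative_diff[OF has_derivative_const dL[OF that]] by simp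
    have r0: "r y = 0" by (simp add: r_def u_def L_M that)
    have "((\<lambda>z. \<Sum>b\<in>Basis. (r z \<bullet> b) *\<^sub>R M z b) has_derivative (\<lambda>w. \<Sum>b\<in>Basis. (r' w \<bullet> b) *\<^sub>R M y b)) (at y)"
      using r0 by (intro has_derivative_sum has_derivative_scaleR_at_zero contM that
          has_derivative_inner_left r) auto
    moreover have "(\<lambda>w. \<Sum>b\<in>Basis. (r' w \<bullet> b) *\<^sub>R M y b) = Q y v"
    proof
      fix w
      show "(\<Sum>b\<in>Basis. (r' w \<bullet> b) *\<^sub>R M y b) = Q y v w"
      using linear_basis_expand[OF linM[OF that], of "r' w"] linM[OF that]
      by (simp add: Q_def r'_def u_def linear_neg)
    qed
    ultimately have "((\<lambda>z. \<Sum>b\<in>Basis. (r z \<bullet> b) *\<^sub>R M z b) has_derivative Q y v) (at y)"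
      by simp
    from has_derivative_add[OF has_derivative_const[of u] this]
    have "((\<lambda>z. u + (\<Sum>b\<in>Basis. (r z \<bullet> b) *\<^sub>R M z b)) has_derivative Q y v) (at y)"
      by simp
    then show ?thesis
    proof (rule has_derivative_transform_within_open[OF _ \<open>open V\<close> that])
      fix z assume z: "z \<in> V"
      have "(\<Sum>b\<in>Basis. (r z \<bullet> b) *\<^sub>R M z b) = M z (r z)"
        using linear_basis_expand[OF linM[OF z], of "r z"] by simp
      also have "\<dots> = M z v - u" using linM[OF z] by (simp add: r_def linear_diff M_L z)
      finally show "u + (\<Sum>b\<in>Basis. (r z \<bullet> b) *\<^sub>R M z b) = M z v" by simp
    qed
  qed
  have CM: "Ck_on k V (\<lambda>y. M y v)" for k v
  proof (induction k arbitrary: v)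
    case 0
    then show ?case using contM by (auto intro: continuous_at_imp_continuous_on)
  next
    case (Suc k)
    have Cg: "Ck_on k V g"
      by (rule Ck_on_pred, rule Ck_on_SucI[OF \<open>open V\<close> dg Suc.IH])
    have lin1: "linear (frechet_derivative (\<lambda>x. frechet_derivative f (at x) u) (at (g y)))" if "y \<in> V" for y u
      using has_derivative_linear[OF smooth_on_has_derivative[OF smooth_on_derivative[OF f, of u] gU[OF that]]] .
    \<comment> \<open>Both arguments of the second derivative move with \<open>y\<close>, so linearity is needed in each of them.\<close>
    have lin2: "linear (\<lambda>u. frechet_derivative (\<lambda>x. frechet_derivative f (at x) u) (at (g y)) a)" if "y \<in> V" for y a
    proof (rule linearI)
      fix u u' :: 'a and s :: real
      have lf: "linear (frechet_derivative f (at x))" if "x \<in> U" for x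
        using has_derivative_linear[OF smooth_on_has_derivative[OF f that]] .
      note d = smooth_on_has_derivative[OF smooth_on_derivative[OF f] gU[OF that]]
      have "((\<lambda>x. frechet_derivative f (at x) (u + u')) has_derivative
          (\<lambda>h. frechet_derivative (\<lambda>x. frechet_derivative f (at x) u) (at (g y)) h +
               frechet_derivative (\<lambda>x. frechet_derivative f (at x) u') (at (g y)) h)) (at (g y))"
        by (rule has_derivative_transform_within_open[OF has_derivative_add[OF d[of u] d[of u']]
              \<open>open U\<close> gU[OF that]]) (simp add: linear_add[OF lf])
      from fun_cong[OF frechet_derivative_at[OF this], of a]
      show "frechet_derivative (\<lambda>x. frechet_derivative f (at x) (u + u')) (at (g y)) a =
        frechet_derivative (\<lambda>x. frechet_derivative f (at x) u) (at (g y)) a +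
        frechet_derivative (\<lambda>x. frechet_derivative f (at x) u') (at (g y)) a" by simp
      have "((\<lambda>x. frechet_derivative f (at x) (s *\<^sub>R u)) has_derivative
          (\<lambda>h. s *\<^sub>R frechet_derivative (\<lambda>x. frechet_derivative f (at x) u) (at (g y)) h)) (at (g y))"
        by (rule has_derivative_transform_within_open[OF has_derivative_scaleR_right[OF d[of u], of s]
              \<open>open U\<close> gU[OF that]]) (simp add: linear_scale[OF lf])
      from fun_cong[OF frechet_derivative_at[OF this], of a]
      show "frechet_derivative (\<lambda>x. frechet_derivative f (at x) (s *\<^sub>R u)) (at (g y)) a =
        s *\<^sub>R frechet_derivative (\<lambda>x. frechet_derivative f (at x) u) (at (g y)) a" by simp
    qed
    have C1: "Ck_on k V (\<lambda>y. frechet_derivative (\<lambda>x. frechet_derivative f (at x) u) (at (g y)) a)" for u a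
    proof -
      have "Ck_on k V ((\<lambda>x. frechet_derivative (\<lambda>x. frechet_derivative f (at x) u) (at x) a) \<circ> g)"
        by (rule Ck_on_compose[OF \<open>open V\<close> \<open>open U\<close> _ Cg])
          (use gU f in \<open>auto intro!: smooth_onD smooth_on_derivative\<close>)
      then show ?thesis by (simp add: o_def)
    qed
    have "Ck_on k V (\<lambda>y. Q y v w)" for w
    proof -
      have C2: "Ck_on k V (\<lambda>y. frechet_derivative (\<lambda>x. frechet_derivative f (at x) (M y v)) (at (g y)) a)" for a
        by (rule Ck_on_apply[where L = "\<lambda>y u. frechet_derivative (\<lambda>x. frechet_derivative f (at x) u) (at (g y)) a",
              OF \<open>open V\<close> lin2 C1 Suc.IH])
      have C3: "Ck_on k V (\<lambda>y. frechet_derivative (\<lambda>x. frechet_derivative f (at x) (M y v)) (at (g y)) (M y w))"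
        by (rule Ck_on_apply[OF \<open>open V\<close> lin1 C2 Suc.IH])
      show ?thesis unfolding Q_def
        by (rule Ck_on_bounded_linear[OF bounded_linear_minus[OF bounded_linear_ident] \<open>open V\<close>
              Ck_on_apply[OF \<open>open V\<close> linM Suc.IH C3]])
    qed
    from Ck_on_SucI[OF \<open>open V\<close> dM this] show ?case .
  qed
  show ?thesis unfolding smooth_on_def
    by (intro allI Ck_on_pred[OF Ck_on_SucI[OF \<open>open V\<close> dg CM]])
qed

lemma smooth_local_inverse:
  fixes f :: "'a::euclidean_space \<Rightarrow> 'a"
  assumes "open S" "x0 \<in> S" and f: "smooth_on S f" and inj0: "inj (frechet_derivative f (at x0))"
  obtains U V g where "open U" "x0 \<in> U" "U \<subseteq> S" "open V" "homeomorphism U V f g" "smooth_on V g"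
proof -
  define f' where "f' x = Blinfun (frechet_derivative f (at x))" for x
  have ap: "blinfun_apply (f' x) = frechet_derivative f (at x)" if "x \<in> S" for x
    unfolding f'_def using smooth_on_has_derivative[OF f that]
    by (intro bounded_linear_Blinfun_apply) (simp add: has_derivative_bounded_linear)
  have lin0: "linear (frechet_derivative f (at x0))"
    using has_derivative_linear[OF smooth_on_has_derivative[OF f assms(2)]] .
  obtain k where k: "linear k" "k \<circ> frechet_derivative f (at x0) = id"
    using linear_injective_left_inverse[OF lin0 inj0] by blast
  have d: "(f has_derivative blinfun_apply (f' x)) (at x)" if "x \<in> S" for x
    using ap smooth_on_has_derivative[OF f] that by simp
  have c: "continuous_on S f'"
  proof (rule continuous_on_blinfun_componentwise)
    fix i :: 'a
    show "continuous_on S (\<lambda>x. blinfun_apply (f' x) i)"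
      using smooth_on_continuous[OF smooth_on_derivative[OF f, of i]]
      by (rule continuous_on_eq) (simp add: ap)
  qed
  have i: "Blinfun k o\<^sub>L f' x0 = id_blinfun"
    using k ap[OF assms(2)]
    by (intro blinfun_eqI)
      (simp add: bounded_linear_Blinfun_apply linear_conv_bounded_linear[symmetric] fun_eq_iff)
  obtain U V g where *: "open U" "U \<subseteq> S" "x0 \<in> U" "open V" "homeomorphism U V f g"
    and bij: "\<forall>y\<in>V. bij (blinfun_apply (f' (g y)))"
  proof (rule inverse_function_theorem[OF \<open>open S\<close> d c \<open>x0 \<in> S\<close> i])
    fix U' V g
    assume a: "open U'" "U' \<subseteq> S" "x0 \<in> U'" "open V" "homeomorphism U' V f g"
      and b: "\<And>y. y \<in> V \<Longrightarrow> bij (blinfun_apply (f' (g y)))"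
    have "\<forall>y\<in>V. bij (blinfun_apply (f' (g y)))" using b by blast
    from that[OF a this] show thesis .
  qed
  have "inj (frechet_derivative f (at x))" if "x \<in> U" for x
  proof -
    have "f x \<in> V" "g (f x) = x" using *(5) that by (auto simp: homeomorphism_def)
    then have "inj (blinfun_apply (f' x))" using bij bij_is_inj by metis
    then show ?thesis using ap[of x] *(2) that by auto
  qed
  then have "smooth_on V g"
    by (rule smooth_on_inverse[OF *(1,4,5) smooth_on_subset[OF f *(2)]])
  then show thesis by (rule that[OF *(1,3,2,4,5)])
qed

section \<open>Differentials of smooth maps in charts\<close>

text \<open>The differential of \<open>f\<close> at \<open>p\<close> read in arbitrary charts. With \<open>f = id\<close> it is the Jacobian of a
  transition map, so that \<^const>\<open>coords\<close>, \<^const>\<open>coord_vec\<close> and \<^const>\<open>mderiv\<close> are all special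
  cases and a single chain rule serves for all of them.\<close>

definition loc_deriv ::
  "('a \<Rightarrow> 'b) \<Rightarrow> ('a, 'e::euclidean_space) chart \<Rightarrow> ('b, 'f::euclidean_space) chart \<Rightarrow> 'a \<Rightarrow> 'e \<Rightarrow> 'f" where
  "loc_deriv f c c' p = frechet_derivative (snd c' \<circ> f \<circ> cinv c) (at (snd c p))"

lemma homeomorphism_chart:
  assumes "is_chart c"
  shows "homeomorphism (fst c) (snd c ` fst c) (snd c) (cinv c)"
proof -
  obtain \<psi> where h: "homeomorphism (fst c) (snd c ` fst c) (snd c) \<psi>"
    using assms by (auto simp: is_chart_def)
  have inj: "inj_on (snd c) (fst c)" by (rule inj_on_inverseI[of _ \<psi>]) (rule homeomorphism_apply1[OF h])
  show ?thesis
    by (rule homeomorphism_cong[OF h])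
      (auto simp: cinv_def inv_into_f_f[OF inj] homeomorphism_apply1[OF h])
qed

lemma cinv_chart [simp]: "is_chart c \<Longrightarrow> p \<in> fst c \<Longrightarrow> cinv c (snd c p) = p"
  using homeomorphism_chart homeomorphism_apply1 by blast

lemma chart_cinv [simp]: "is_chart c \<Longrightarrow> x \<in> snd c ` fst c \<Longrightarrow> snd c (cinv c x) = x"
  using homeomorphism_chart homeomorphism_apply2 by blast

lemma open_chart_image:
  assumes "is_chart c" "open U"
  shows "open (snd c ` (fst c \<inter> U))"
proof -
  have "openin (top_of_set (snd c ` fst c)) (snd c ` (fst c \<inter> U))"
    using homeomorphism_imp_open_map[OF homeomorphism_chart[OF assms(1)], of "fst c \<inter> U"] assms(2)
    by (simp add: openin_open_Int)
  then show ?thesis using assms(1) openin_open_trans by (auto simp: is_chart_def)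
qed

lemma open_local_domain:
  assumes "is_chart c" "is_chart c'" "continuous_on UNIV f"
  shows "open (snd c ` (fst c \<inter> f -` fst c'))"
  using assms by (intro open_chart_image open_vimage) (auto simp: is_chart_def)

lemma loc_deriv_works:
  assumes "smooth_map A B f" "c \<in> A" "c' \<in> B" "p \<in> fst c" "f p \<in> fst c'"
  shows "(snd c' \<circ> f \<circ> cinv c has_derivative loc_deriv f c c' p) (at (snd c p))"
  unfolding loc_deriv_def
  using assms by (intro smooth_on_has_derivative[of "snd c ` (fst c \<inter> f -` fst c')"])
    (auto simp: smooth_map_def)

lemma linear_loc_deriv:
  assumes "smooth_map A B f" "c \<in> A" "c' \<in> B" "p \<in> fst c" "f p \<in> fst c'"
  shows "linear (loc_deriv f c c' p)"
  using loc_deriv_works[OF assms] by (rule has_derivative_linear)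

text \<open>The chain rule. The intermediate chart \<open>c'\<close> is arbitrary, which also gives the independence of the
  choice of charts.\<close>

lemma loc_deriv_compose:
  assumes f: "smooth_map A B f" and g: "smooth_map B C g" and c: "c \<in> A" "c' \<in> B" "c'' \<in> C"
    and ch: "is_chart c" "is_chart c'" and p: "p \<in> fst c" "f p \<in> fst c'" "g (f p) \<in> fst c''"
  shows "loc_deriv (g \<circ> f) c c'' p = loc_deriv g c' c'' (f p) \<circ> loc_deriv f c c' p"
proof -
  let ?D = "snd c ` (fst c \<inter> f -` fst c')"
  have *: "(snd c' \<circ> f \<circ> cinv c) (snd c p) = snd c' (f p)" using ch p by simp
  have "((snd c'' \<circ> g \<circ> cinv c') \<circ> (snd c' \<circ> f \<circ> cinv c) has_derivative
      loc_deriv g c' c'' (f p) \<circ> loc_deriv f c c' p) (at (snd c p))"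
    by (rule diff_chain_at[OF loc_deriv_works[OF f c(1,2) p(1,2)]])
      (use loc_deriv_works[OF g c(2,3) p(2,3)] * in simp)
  moreover have "open ?D" using ch f by (intro open_local_domain) (auto simp: smooth_map_def)
  ultimately have "(snd c'' \<circ> (g \<circ> f) \<circ> cinv c has_derivative
      loc_deriv g c' c'' (f p) \<circ> loc_deriv f c c' p) (at (snd c p))"
  proof (rule has_derivative_transform_within_open)
    show "((snd c'' \<circ> g \<circ> cinv c') \<circ> (snd c' \<circ> f \<circ> cinv c)) x = (snd c'' \<circ> (g \<circ> f) \<circ> cinv c) x"
      if "x \<in> ?D" for x using that ch by auto
  qed (use p in auto)
  then show ?thesis
    unfolding loc_deriv_def[of "g \<circ> f"] by (rule frechet_derivative_at[symmetric])
qed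

lemma loc_deriv_id:
  assumes "is_chart c" "p \<in> fst c"
  shows "loc_deriv id c c p = id"
proof -
  have "(snd c \<circ> id \<circ> cinv c has_derivative id) (at (snd c p))"
  proof (rule has_derivative_transform_within_open[OF has_derivative_id])
    show "open (snd c ` fst c)" using assms by (simp add: is_chart_def)
  qed (use assms in auto)
  then show ?thesis unfolding loc_deriv_def by (rule frechet_derivative_at[symmetric])
qed

lemma smooth_structure_is_chart: "smooth_structure A \<Longrightarrow> c \<in> A \<Longrightarrow> is_chart c"
  by (simp add: smooth_structure_def)

lemma smooth_map_id: "smooth_structure A \<Longrightarrow> smooth_map A A id"
  by (simp add: smooth_map_def smooth_structure_def compatible_def)

lemma chart_at:
  assumes "smooth_structure A"
  shows "chart_at A p \<in> A" "p \<in> fst (chart_at A p)"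
proof -
  have "p \<in> (\<Union>c\<in>A. fst c)" using assms unfolding smooth_structure_def by (metis UNIV_I)
  then have "\<exists>c. c \<in> A \<and> p \<in> fst c" by blast
  from someI_ex[OF this] show "chart_at A p \<in> A" "p \<in> fst (chart_at A p)"
    by (auto simp: chart_at_def)
qed

lemma coords_eq_loc_deriv: "coords A c p = loc_deriv id (chart_at A p) c p"
  by (simp add: coords_def loc_deriv_def)

lemma coord_vec_eq_loc_deriv: "coord_vec A c p = loc_deriv id c (chart_at A p) p"
  by (simp add: coord_vec_def loc_deriv_def)

lemma mderiv_eq_loc_deriv: "mderiv A B f p = loc_deriv f (chart_at A p) (chart_at B (f p)) p"
  by (simp add: mderiv_def loc_deriv_def)

context
  fixes A :: "('a::{t2_space,second_countable_topology}, 'e::euclidean_space) chart set"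
  assumes A: "smooth_structure A"
begin

lemma linear_coords: "c \<in> A \<Longrightarrow> p \<in> fst c \<Longrightarrow> linear (coords A c p)"
  unfolding coords_eq_loc_deriv
  by (rule linear_loc_deriv[OF smooth_map_id[OF A]]) (simp_all add: chart_at A)

lemma linear_coord_vec: "c \<in> A \<Longrightarrow> p \<in> fst c \<Longrightarrow> linear (coord_vec A c p)"
  unfolding coord_vec_eq_loc_deriv
  by (rule linear_loc_deriv[OF smooth_map_id[OF A]]) (simp_all add: chart_at A)

lemma coords_coord_vec:
  assumes "c \<in> A" "p \<in> fst c"
  shows "coords A c p (coord_vec A c p u) = u"
  using loc_deriv_compose[OF smooth_map_id[OF A] smooth_map_id[OF A], of c "chart_at A p" c p]
    loc_deriv_id[of c p] assms
  by (simp add: coords_eq_loc_deriv coord_vec_eq_loc_deriv chart_at A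
      smooth_structure_is_chart[OF A] fun_eq_iff)

lemma coord_vec_coords:
  assumes "c \<in> A" "p \<in> fst c"
  shows "coord_vec A c p (coords A c p u) = u"
  using loc_deriv_compose[OF smooth_map_id[OF A] smooth_map_id[OF A], of "chart_at A p" c "chart_at A p" p]
    loc_deriv_id[of "chart_at A p" p] assms
  by (simp add: coords_eq_loc_deriv coord_vec_eq_loc_deriv chart_at A
      smooth_structure_is_chart[OF A] fun_eq_iff)

lemma coords_change:
  assumes "c \<in> A" "p \<in> fst c" "c' \<in> A" "p \<in> fst c'"
  shows "coords A c' p u = loc_deriv id c c' p (coords A c p u)"
  using loc_deriv_compose[OF smooth_map_id[OF A] smooth_map_id[OF A], of "chart_at A p" c c' p] assms
  by (simp add: coords_eq_loc_deriv chart_at A smooth_structure_is_chart[OF A])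

lemma linear_mderiv:
  assumes "smooth_map A A f" shows "linear (mderiv A A f p)"
  unfolding mderiv_eq_loc_deriv
  by (rule linear_loc_deriv[OF assms]) (simp_all add: chart_at A)

lemma coords_mderiv:
  assumes f: "smooth_map A A f" and "c \<in> A" "p \<in> fst c" "c' \<in> A" "f p \<in> fst c'"
  shows "coords A c' (f p) (mderiv A A f p u) = loc_deriv f c c' p (coords A c p u)"
  using loc_deriv_compose[OF f smooth_map_id[OF A], of "chart_at A p" "chart_at A (f p)" c' p]
    loc_deriv_compose[OF smooth_map_id[OF A] f, of "chart_at A p" c c' p] assms
  by (simp add: coords_eq_loc_deriv mderiv_eq_loc_deriv chart_at A smooth_structure_is_chart[OF A])
    (metis comp_apply)

lemma mderiv_involution:
  assumes f: "smooth_map A A f" and "f \<circ> f = id"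
  shows "mderiv A A f (f p) (mderiv A A f p u) = u"
  using loc_deriv_compose[OF f f, of "chart_at A p" "chart_at A (f p)" "chart_at A p" p]
    loc_deriv_id[of "chart_at A p" p] assms(2)
  by (simp add: mderiv_eq_loc_deriv chart_at A smooth_structure_is_chart[OF A] fun_eq_iff)

section \<open>Linearizing an involution near a fixed point\<close>

text \<open>Maximality of the atlas: composing a chart with a diffeomorphism between open subsets of the model
  space gives a chart that is compatible with all the others.\<close>

lemma chart_change_of_coordinates:
  assumes c: "c \<in> A" and W: "open W" "W \<subseteq> snd c ` fst c" "open W'"
    and h: "homeomorphism W W' h h'" "smooth_on W h" "smooth_on W' h'"
  shows "(cinv c ` W, h \<circ> snd c) \<in> A"
proof -
  have ch: "is_chart c" using smooth_structure_is_chart[OF A c] .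
  note homc = homeomorphism_chart[OF ch]
  define c2 where "c2 = (cinv c ` W, h \<circ> snd c)"
  have U: "cinv c ` W \<subseteq> fst c" using W(2) ch by auto
  have sW: "snd c ` cinv c ` W = W" using W(2) ch by (force simp: image_image)
  have hom1: "homeomorphism (cinv c ` W) W (snd c) (cinv c)"
    by (rule homeomorphism_of_subsets[OF homc U W(2) sW])
  have hom2: "homeomorphism (cinv c ` W) W' (h \<circ> snd c) (cinv c \<circ> h')"
    by (rule homeomorphism_compose[OF hom1 h(1)])
  have im2: "snd c2 ` fst c2 = W'" using hom2 by (simp add: c2_def homeomorphism_def)
  have "q \<in> cinv c ` W" if "q \<in> fst c" "snd c q \<in> W" for q
    using imageI[of "snd c q" W "cinv c"] that ch by simp
  then have "cinv c ` W = fst c \<inter> snd c -` W" using W(2) ch U by auto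
  moreover have "open (fst c \<inter> snd c -` W)"
    using homc W(1) ch by (intro continuous_open_preimage) (auto simp: homeomorphism_def is_chart_def)
  ultimately have openU: "open (cinv c ` W)" by simp
  have ch2: "is_chart c2"
    unfolding is_chart_def using im2 hom2 openU W(3) by (auto simp: c2_def)
  have cinv2: "cinv c2 y = cinv c (h' y)" if y: "y \<in> W'" for y
  proof -
    obtain x where x: "x \<in> W" "y = h x" using h(1) y by (auto simp: homeomorphism_def)
    have q: "cinv c x \<in> fst c2" using x by (simp add: c2_def)
    have "snd c2 (cinv c x) = y" using x W(2) ch by (auto simp: c2_def)
    then show ?thesis using cinv_chart[OF ch2 q] x homeomorphism_apply1[OF h(1)] by simp
  qed
  have "compatible c2 c1" if c1: "c1 \<in> A" for c1
    unfolding compatible_def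
  proof
    have ch1: "is_chart c1" using smooth_structure_is_chart[OF A c1] .
    have transition: "smooth_on (snd a ` (fst a \<inter> fst b)) (snd b \<circ> cinv a)" if "a \<in> A" "b \<in> A" for a b
      using smooth_map_id[OF A] that by (simp add: smooth_map_def)
    have comp: "smooth_on (snd c ` (fst c \<inter> fst c1)) (snd c1 \<circ> cinv c)"
      "smooth_on (snd c1 ` (fst c \<inter> fst c1)) (snd c \<circ> cinv c1)"
      using transition[OF c c1] transition[OF c1 c] by (simp_all add: Int_commute)
    have o1: "open (fst c1)" using ch1 by (simp add: is_chart_def)
    have o2: "open (snd c2 ` (fst c2 \<inter> fst c1))" by (rule open_chart_image[OF ch2 o1])
    have o12: "open (snd c1 ` (fst c2 \<inter> fst c1))"
      using open_chart_image[OF ch1, of "fst c2"] ch2 by (simp add: is_chart_def Int_commute)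
    have sub: "snd c2 ` (fst c2 \<inter> fst c1) \<subseteq> W'" using im2 by blast
    have "smooth_on (snd c2 ` (fst c2 \<inter> fst c1)) ((snd c1 \<circ> cinv c) \<circ> h')"
    proof (rule smooth_on_compose[OF o2 open_chart_image[OF ch o1]])
      show "h' ` snd c2 ` (fst c2 \<inter> fst c1) \<subseteq> snd c ` (fst c \<inter> fst c1)"
      proof clarify
        fix q assume q: "q \<in> fst c2" "q \<in> fst c1"
        then have "snd c q \<in> W" "q \<in> fst c" using sW U by (auto simp: c2_def)
        then show "h' (snd c2 q) \<in> snd c ` (fst c \<inter> fst c1)"
          using q homeomorphism_apply1[OF h(1)] by (simp add: c2_def)
      qed
    qed (use smooth_on_subset[OF h(3) sub] comp in auto)
    then show "smooth_on (snd c2 ` (fst c2 \<inter> fst c1)) (snd c1 \<circ> cinv c2)"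
      by (rule smooth_on_cong[OF o2, rotated]) (use sub cinv2 in auto)
    have "smooth_on (snd c1 ` (fst c2 \<inter> fst c1)) (h \<circ> (snd c \<circ> cinv c1))"
    proof (rule smooth_on_compose[OF o12 W(1) _ _ h(2)])
      show "(snd c \<circ> cinv c1) ` snd c1 ` (fst c2 \<inter> fst c1) \<subseteq> W"
        using sW ch1 by (auto simp: c2_def)
      show "smooth_on (snd c1 ` (fst c2 \<inter> fst c1)) (snd c \<circ> cinv c1)"
        by (rule smooth_on_subset[OF comp(2)]) (use U in \<open>auto simp: c2_def\<close>)
    qed
    then show "smooth_on (snd c1 ` (fst c2 \<inter> fst c1)) (snd c2 \<circ> cinv c1)"
      by (simp add: c2_def o_assoc)
  qed
  then have "is_chart c2 \<and> (\<forall>c'\<in>A. compatible c2 c')" using ch2 by blast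
  moreover have "\<forall>c. is_chart c \<and> (\<forall>c'\<in>A. compatible c c') \<longrightarrow> c \<in> A"
    using A unfolding smooth_structure_def by (elim conjE)
  ultimately have "c2 \<in> A" by (elim allE[of _ c2] impE)
  then show ?thesis by (simp add: c2_def)
qed

text \<open>Averaging (H. Cartan): let \<open>s\<close> be \<open>\<sigma>\<close> read in the chart \<open>c\<close>, let \<open>x0\<close> be the image of \<open>p\<close>, and
  \<open>L = Ds(x0)\<close>, so that \<open>L\<^sup>2 = 1\<close>. The map \<open>h(x) = ((x - x0) + L (s x - x0)) / 2\<close> satisfies
  \<open>h \<circ> s = L \<circ> h\<close>, and \<open>Dh(x0) = (1 + L\<^sup>2) / 2 = 1\<close>, so it is a local diffeomorphism. In the chart
  \<open>h \<circ> c\<close> the involution is the linear map \<open>L\<close>, and its fixed points are those of \<open>L\<close>. The last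
  conclusion expresses that the change of coordinates is an average of \<open>1\<close> and \<open>L Ds\<close>; hence it
  commutes with every linear map with which \<open>Ds\<close> commutes at all points, and a chart adapted to a
  complex structure preserved by \<open>\<sigma>\<close> remains adapted to it.\<close>

lemma involution_linearizing_chart:
  assumes c: "c \<in> A" and p: "p \<in> fst c" and \<sigma>: "smooth_map A A \<sigma>" "\<sigma> \<circ> \<sigma> = id" and fix_p: "\<sigma> p = p"
  defines "L \<equiv> loc_deriv \<sigma> c c p"
  obtains c' where "c' \<in> A" "p \<in> fst c'" "fst c' \<subseteq> fst c" "\<forall>q\<in>fst c'. \<sigma> q \<in> fst c"
    "snd c' ` (fst c' \<inter> {q. \<sigma> q = q}) = snd c' ` fst c' \<inter> {v. L v = v}"
    "\<forall>q\<in>fst c'. \<forall>v.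
      coords A c' q v = (1/2) *\<^sub>R (coords A c q v + L (loc_deriv \<sigma> c c q (coords A c q v)))"
proof -
  have ch: "is_chart c" using smooth_structure_is_chart[OF A c] .
  define s where "s = snd c \<circ> \<sigma> \<circ> cinv c"
  define x0 where "x0 = snd c p"
  define D where "D = snd c ` (fst c \<inter> \<sigma> -` fst c)"
  have ss: "\<sigma> (\<sigma> q) = q" for q using \<sigma>(2) by (metis comp_apply id_apply)
  have openD: "open D" unfolding D_def
    using ch \<sigma>(1) by (intro open_local_domain) (auto simp: smooth_map_def)
  have x0D: "x0 \<in> D" using p fix_p by (auto simp: D_def x0_def)
  have sm: "smooth_on D s" using \<sigma>(1) c by (simp add: smooth_map_def D_def s_def)
  have s_chart: "s (snd c q) = snd c (\<sigma> q)" if "q \<in> fst c" for q using that ch by (simp add: s_def)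
  have sD: "s x \<in> D" and ssx: "s (s x) = x" if "x \<in> D" for x
    using that ch ss by (auto simp: D_def s_def)
  have linL: "linear L" unfolding L_def using \<sigma>(1) c p fix_p by (intro linear_loc_deriv) auto
  have ds: "(s has_derivative loc_deriv \<sigma> c c q) (at (snd c q))" if "q \<in> fst c" "\<sigma> q \<in> fst c" for q
    unfolding s_def using loc_deriv_works[OF \<sigma>(1) c c that] .
  have LL: "L (L v) = v" for v
    using loc_deriv_compose[OF \<sigma>(1) \<sigma>(1) c c c ch ch p] fix_p p \<sigma>(2) loc_deriv_id[OF ch p]
    by (simp add: L_def fun_eq_iff)
  define h where "h x = (1/2) *\<^sub>R ((x - x0) + L (s x - x0))" for x
  have blL: "bounded_linear L" using linL by (simp add: linear_conv_bounded_linear)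
  have smh: "smooth_on D h"
  proof -
    have "smooth_on D (\<lambda>x. (x + - x0) + L (s x + - x0))"
      by (intro smooth_on_add smooth_on_bounded_linear[OF blL] openD smooth_on_id smooth_on_const sm)
    from smooth_on_bounded_linear[OF bounded_linear_scaleR_right[of "1/2"] openD this]
    show ?thesis by (simp add: h_def[abs_def])
  qed
  have dh: "(h has_derivative (\<lambda>v. (1/2) *\<^sub>R (v + L (loc_deriv \<sigma> c c q v)))) (at (snd c q))"
    if "q \<in> fst c" "\<sigma> q \<in> fst c" for q
    unfolding h_def
    by (auto intro!: derivative_eq_intros bounded_linear.has_derivative[OF blL] ds[OF that])
  have "frechet_derivative h (at x0) = (\<lambda>v. (1/2) *\<^sub>R (v + L (L v)))"
    using frechet_derivative_at[OF dh[of p]] p fix_p by (simp add: x0_def L_def)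
  also have "\<dots> = id" by (auto simp: LL scaleR_2[symmetric])
  finally have "inj (frechet_derivative h (at x0))" by simp
  from smooth_local_inverse[OF openD x0D smh this]
  obtain U V h' where U: "open U" "x0 \<in> U" "U \<subseteq> D" "open V" "homeomorphism U V h h'" "smooth_on V h'"
    by metis
  \<comment> \<open>Shrinking to an invariant neighbourhood keeps \<open>\<sigma> q\<close> in the domain where \<open>h\<close> is injective.\<close>
  define W where "W = U \<inter> s -` U"
  define W' where "W' = h ` W"
  have WU: "W \<subseteq> U" by (auto simp: W_def)
  have openW: "open W"
    unfolding W_def using smooth_on_continuous[OF smooth_on_subset[OF sm U(3)]] U(1)
    by (intro continuous_open_preimage) auto
  have hom: "homeomorphism W W' h h'"
    using homeomorphism_of_subsets[OF U(5) WU order_refl] by (simp add: W'_def)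
  have W'V: "W' \<subseteq> V" using U(5) WU by (auto simp: W'_def homeomorphism_def)
  have "openin (top_of_set V) W'"
    unfolding W'_def using homeomorphism_imp_open_map[OF U(5)] openW WU by (simp add: open_subset)
  then have openW': "open W'" using U(4) openin_open_trans by blast
  have DC: "D \<subseteq> snd c ` fst c" by (auto simp: D_def)
  define c' where "c' = (cinv c ` W, h \<circ> snd c)"
  have c'A: "c' \<in> A"
    unfolding c'_def
    by (rule chart_change_of_coordinates[OF c openW _ openW' hom])
      (use WU U(3) DC smooth_on_subset[OF smh] smooth_on_subset[OF U(6) W'V] in auto)
  have mem: "q \<in> fst c' \<longleftrightarrow> q \<in> fst c \<and> snd c q \<in> W" for q
  proof
    assume "q \<in> fst c'"
    then obtain x where x: "x \<in> W" "q = cinv c x" by (auto simp: c'_def)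
    then have "x \<in> snd c ` fst c" using WU U(3) DC by blast
    then show "q \<in> fst c \<and> snd c q \<in> W" using x ch by auto
  next
    assume "q \<in> fst c \<and> snd c q \<in> W"
    then show "q \<in> fst c'" using imageI[of "snd c q" W "cinv c"] ch by (simp add: c'_def)
  qed
  have WD: "q \<in> fst c \<Longrightarrow> snd c q \<in> W \<Longrightarrow> \<sigma> q \<in> fst c" for q
  proof -
    assume q: "q \<in> fst c" "snd c q \<in> W"
    then obtain r where "r \<in> fst c" "\<sigma> r \<in> fst c" "snd c q = snd c r"
      using WU U(3) by (auto simp: D_def)
    then show "\<sigma> q \<in> fst c" using cinv_chart[OF ch] q(1) by metis
  qed
  have sW: "s x \<in> W" if "x \<in> W" for x using that ssx U(3) by (auto simp: W_def)
  have inv: "\<sigma> q \<in> fst c'" if "q \<in> fst c'" for q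
    using that WD sW[of "snd c q"] s_chart by (auto simp: mem)
  have x0W: "x0 \<in> W" using U(2) s_chart[OF p] fix_p by (simp add: W_def x0_def)
  show thesis
  proof (rule that[OF c'A])
    show "p \<in> fst c'" using p x0W by (simp add: mem x0_def)
    show "fst c' \<subseteq> fst c" using mem by blast
    show "\<forall>q\<in>fst c'. \<sigma> q \<in> fst c" using WD mem by blast
    have Lh: "L (h (snd c q)) = h (snd c (\<sigma> q))" if "q \<in> fst c'" for q
    proof -
      have q: "q \<in> fst c" "\<sigma> q \<in> fst c" using that WD mem by auto
      show ?thesis
        by (simp add: h_def s_chart q ss linear_scale[OF linL] linear_add[OF linL] LL add.commute)
    qed
    have fixed: "\<sigma> q = q \<longleftrightarrow> L (h (snd c q)) = h (snd c q)" if "q \<in> fst c'" for q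
    proof
      assume "L (h (snd c q)) = h (snd c q)"
      then have "h (snd c (\<sigma> q)) = h (snd c q)" using Lh[OF that] by simp
      moreover have "snd c (\<sigma> q) \<in> W" "snd c q \<in> W" using that inv mem by auto
      ultimately have "snd c (\<sigma> q) = snd c q" using homeomorphism_apply1[OF hom] by metis
      moreover have "q \<in> fst c" "\<sigma> q \<in> fst c" using that inv mem by auto
      ultimately show "\<sigma> q = q" using cinv_chart[OF ch] by metis
    qed (use Lh[OF that] in simp)
    show "snd c' ` (fst c' \<inter> {q. \<sigma> q = q}) = snd c' ` fst c' \<inter> {v. L v = v}"
      using fixed by (auto simp: c'_def)
    show "\<forall>q\<in>fst c'. \<forall>v.
      coords A c' q v = (1/2) *\<^sub>R (coords A c q v + L (loc_deriv \<sigma> c c q (coords A c q v)))"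
    proof (intro ballI allI)
      fix q v assume q': "q \<in> fst c'"
      have q: "q \<in> fst c" "\<sigma> q \<in> fst c" using q' WD mem by auto
      have "(snd c' \<circ> id \<circ> cinv c has_derivative (\<lambda>v. (1/2) *\<^sub>R (v + L (loc_deriv \<sigma> c c q v)))) (at (snd c q))"
        by (rule has_derivative_transform_within_open[OF dh[OF q] openW])
          (use q' mem WU U(3) DC ch in \<open>auto simp: c'_def subset_iff\<close>)
      from frechet_derivative_at[OF this]
      have "loc_deriv id c c' q = (\<lambda>v. (1/2) *\<^sub>R (v + L (loc_deriv \<sigma> c c q v)))"
        by (simp add: loc_deriv_def)
      then show "coords A c' q v = (1/2) *\<^sub>R (coords A c q v + L (loc_deriv \<sigma> c c q (coords A c q v)))"
        using coords_change[OF c q(1) c'A q'] by simp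
    qed
  qed
qed

text \<open>The definition of \<^const>\<open>tangent_of\<close> allows every slice chart, not only a linearizing one. In any of
  them a short segment through \<open>p\<close> with direction \<open>u\<close> lies in the fixed locus; differentiate
  \<open>\<sigma>\<close> along it.\<close>

lemma tangent_of_fixed_points:
  assumes \<sigma>: "smooth_map A A \<sigma>" and fix_p: "\<sigma> p = p" and u: "u \<in> tangent_of A {q. \<sigma> q = q} p"
  shows "mderiv A A \<sigma> p u = u"
proof -
  obtain c V where c: "c \<in> A" and V: "subspace V"
    and sl: "snd c ` (fst c \<inter> {q. \<sigma> q = q}) = snd c ` fst c \<inter> V"
    and p: "p \<in> fst c" and w: "coords A c p u \<in> V"
    using u by (auto simp: tangent_of_def slice_chart_def)
  have ch: "is_chart c" using smooth_structure_is_chart[OF A c] .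
  define w where "w = coords A c p u"
  define x0 where "x0 = snd c p"
  have x0V: "x0 \<in> V" using sl p fix_p by (auto simp: x0_def)
  have ev: "\<forall>\<^sub>F t in at (0::real). x0 + t *\<^sub>R w \<in> snd c ` fst c"
  proof -
    have "((\<lambda>t. x0 + t *\<^sub>R w) \<longlongrightarrow> x0 + 0 *\<^sub>R w) (at 0)" by (intro tendsto_intros)
    moreover have "open (snd c ` fst c)" using ch by (simp add: is_chart_def)
    ultimately show ?thesis using p by (intro topological_tendstoD) (auto simp: x0_def)
  qed
  define s where "s = snd c \<circ> \<sigma> \<circ> cinv c"
  have fixs: "s (x0 + t *\<^sub>R w) = x0 + t *\<^sub>R w" if "x0 + t *\<^sub>R w \<in> snd c ` fst c" for t
  proof -
    have "x0 + t *\<^sub>R w \<in> V" using x0V w V by (simp add: w_def subspace_add subspace_scale)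
    then have "x0 + t *\<^sub>R w \<in> snd c ` (fst c \<inter> {q. \<sigma> q = q})" using that sl by simp
    then show ?thesis using ch by (auto simp: s_def)
  qed
  have "((\<lambda>t. s (x0 + t *\<^sub>R w)) has_derivative (\<lambda>t. loc_deriv \<sigma> c c p (t *\<^sub>R w))) (at 0)"
  proof (rule has_derivative_compose[where f="\<lambda>t. x0 + t *\<^sub>R w" and f'="\<lambda>t. t *\<^sub>R w" and g=s
        and g'="loc_deriv \<sigma> c c p"])
    show "((\<lambda>t. x0 + t *\<^sub>R w) has_derivative (\<lambda>t. t *\<^sub>R w)) (at 0)"
      by (auto intro!: derivative_eq_intros)
    show "(s has_derivative loc_deriv \<sigma> c c p) (at (x0 + 0 *\<^sub>R w))"
      using loc_deriv_works[OF \<sigma> c c p] fix_p p by (simp add: s_def x0_def)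
  qed
  moreover have "((\<lambda>t. s (x0 + t *\<^sub>R w)) has_derivative (\<lambda>t. t *\<^sub>R w)) (at 0)"
  proof (rule has_derivative_transform_eventually[where f="\<lambda>t. x0 + t *\<^sub>R w"])
    show "((\<lambda>t. x0 + t *\<^sub>R w) has_derivative (\<lambda>t. t *\<^sub>R w)) (at 0)"
      by (auto intro!: derivative_eq_intros)
    show "\<forall>\<^sub>F t in at 0. x0 + t *\<^sub>R w = s (x0 + t *\<^sub>R w)"
      using ev by eventually_elim (simp add: fixs)
    show "x0 + 0 *\<^sub>R w = s (x0 + 0 *\<^sub>R w)" using fixs[of 0] p by (simp add: x0_def)
  qed simp
  ultimately have "(\<lambda>t::real. loc_deriv \<sigma> c c p (t *\<^sub>R w)) = (\<lambda>t. t *\<^sub>R w)"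
    by (rule has_derivative_unique)
  from fun_cong[OF this, of 1] have "loc_deriv \<sigma> c c p w = w" by simp
  then have "coords A c p (mderiv A A \<sigma> p u) = coords A c p u"
    using coords_mderiv[OF \<sigma> c p c] fix_p p by (simp add: w_def)
  then show ?thesis using coord_vec_coords[OF c p] by metis
qed

end

section \<open>Linear algebra\<close>

lemma scaleR_eq_complex_scale: "r *\<^sub>R v = complex_of_real r *s v" for v :: "complex^'n"
  by (simp add: vec_eq_iff) (simp add: scaleR_conv_of_real)

text \<open>Adding a vector \<open>b\<close> to a complex basis adds the real plane \<open>\<complex> b\<close>, which meets the complex span of the
  other vectors only in \<open>0\<close>.\<close>

lemma dim_eq_twice_complex_dim:
  fixes V :: "(complex^'n) set"
  assumes "vec.subspace V"
  shows "dim V = 2 * vec.dim V"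
proof -
  have span_dim: "dim (vec.span B) = 2 * card B" if "finite B" "vec.independent B" for B :: "(complex^'n) set"
    using that
  proof (induction B)
    case empty
    then show ?case by simp
  next
    case (insert b B)
    let ?P = "vec.span B" and ?Q = "range (\<lambda>z. z *s b)"
    have sub: "subspace ?P"
      by (auto simp: subspace_def scaleR_eq_complex_scale vec.span_zero vec.span_add vec.span_scale)
    have lin: "linear (\<lambda>z. z *s b)"
      by (rule linearI, simp add: vec.scale_left_distrib, simp add: scaleR_eq_complex_scale)
        (simp add: scaleR_conv_of_real)
    have b: "b \<notin> ?P" "b \<noteq> 0"
      using insert.prems insert.hyps vec.independent_insert[of b B] by (auto simp: vec.span_zero)
    have "inj (\<lambda>z. z *s b)" using b(2) by (auto intro!: injI)
    then have dQ: "dim ?Q = 2"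
      using dim_image_eq[of "\<lambda>z. z *s b" UNIV] lin by (simp add: inj_on_subset)
    have subQ: "subspace ?Q" using lin subspace_UNIV by (rule linear_subspace_image)
    have "x = 0" if x: "x \<in> ?P" "x \<in> ?Q" for x
    proof (rule ccontr)
      assume "x \<noteq> 0"
      moreover obtain z where z: "x = z *s b" using x(2) by blast
      ultimately have "z \<noteq> 0" by auto
      then have "b = inverse z *s x" by (simp add: z vec_eq_iff)
      then show False using b(1) x(1) vec.span_scale by metis
    qed
    then have "?P \<inter> ?Q = {0}" using vec.span_zero[of B] subspace_0[OF subQ] by auto
    moreover have "vec.span (insert b B) = {x + y |x y. x \<in> ?P \<and> y \<in> ?Q}"
    proof (intro set_eqI iffI)
      fix v assume "v \<in> vec.span (insert b B)"
      then obtain k where "v - k *s b \<in> ?P" by (auto simp: vec.span_insert)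
      then show "v \<in> {x + y |x y. x \<in> ?P \<and> y \<in> ?Q}"
        by (intro CollectI exI[of _ "v - k *s b"] exI[of _ "k *s b"]) auto
    next
      fix v assume "v \<in> {x + y |x y. x \<in> ?P \<and> y \<in> ?Q}"
      then obtain x z where "x \<in> ?P" "v = x + z *s b" by blast
      then have "v - z *s b \<in> ?P" by simp
      then show "v \<in> vec.span (insert b B)" unfolding vec.span_insert by blast
    qed
    ultimately show ?case
      using dim_sums_Int[OF sub subQ] insert by (simp add: dQ vec.independent_insert split: if_splits)
  qed
  obtain B where B: "B \<subseteq> V" "vec.independent B" "V \<subseteq> vec.span B" "card B = vec.dim V"
    using vec.basis_exists by blast
  have "vec.span B = V" using B assms vec.span_minimal by blast
  then show ?thesis using span_dim[OF vec.finiteI_independent[OF B(2)] B(2)] B(4) by simp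
qed

text \<open>\<open>T\<close> maps each of the eigenspaces of \<open>L\<close> for \<open>1\<close> and \<open>-1\<close> injectively into the other, so they have
  the same dimension, and their direct sum is the whole space.\<close>

lemma dim_fixed_space_of_involution:
  fixes L T :: "'e::euclidean_space \<Rightarrow> 'e"
  assumes L: "linear L" "\<And>v. L (L v) = v" and T: "linear T" "inj T" and anti: "\<And>v. L (T v) = - T (L v)"
  shows "2 * dim {v. L v = v} = DIM('e)"
proof -
  let ?P = "{v. L v = v}" and ?N = "{v. L v = - v}"
  have P: "subspace ?P" and N: "subspace ?N"
    using L(1) by (auto simp: subspace_def linear_0 linear_add linear_scale)
  have le: "dim (T ` X) = dim X" for X
    using T by (intro dim_image_eq) (auto intro: inj_on_subset)
  have "dim (T ` ?P) \<le> dim ?N" "dim (T ` ?N) \<le> dim ?P"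
    using anti T(1) by (auto intro!: dim_subset simp: linear_neg)
  then have eq: "dim ?P = dim ?N" by (simp add: le)
  have "v \<in> {x + y |x y. x \<in> ?P \<and> y \<in> ?N}" for v
  proof (intro CollectI exI conjI)
    show "v = (1/2) *\<^sub>R (v + L v) + (1/2) *\<^sub>R (v - L v)"
      by (simp add: algebra_simps flip: scaleR_add_left)
  qed (simp_all add: L linear_add linear_diff linear_scale add.commute flip: scaleR_minus_right)
  then have "{x + y |x y. x \<in> ?P \<and> y \<in> ?N} = UNIV" by blast
  moreover have "x = 0" if "- x = x" for x :: 'e
    using that scaleR_2[of x] by (metis add.right_inverse scaleR_eq_0_iff zero_neq_numeral)
  then have "?P \<inter> ?N = {0}" using L(1) by (auto simp: linear_0)
  ultimately show ?thesis using dim_sums_Int[OF P N] eq by simp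
qed

text \<open>An exterior power is a polynomial with rational coefficients in the values of the form on the given
  vectors.\<close>

lemma wedge_power_real:
  assumes real: "\<And>u v. u \<in> T \<Longrightarrow> v \<in> T \<Longrightarrow> \<theta> u v \<in> \<real>"
  shows "(\<And>i. i < 2 * n \<Longrightarrow> v i \<in> T) \<Longrightarrow> wedge_power \<theta> n v \<in> \<real>"
proof (induction n arbitrary: v)
  case (Suc n)
  have "of_int (sign \<pi>) * \<theta> (v (\<pi> 0)) (v (\<pi> 1)) * wedge_power \<theta> n (\<lambda>i. v (\<pi> (2 + i))) \<in> \<real>"
    if \<pi>: "\<pi> permutes {..<2 + 2 * n}" for \<pi>
  proof -
    have T: "v (\<pi> i) \<in> T" if "i < 2 + 2 * n" for i
      using Suc.prems permutes_in_image[OF \<pi>, of i] that by simp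
    then have "wedge_power \<theta> n (\<lambda>i. v (\<pi> (2 + i))) \<in> \<real>" by (intro Suc.IH) simp
    with T show ?thesis by (intro Reals_mult real) auto
  qed
  moreover have "fact k \<in> (\<real> :: complex set)" for k by (metis Reals_of_nat of_nat_fact)
  then have "fact 2 * fact (2 * n) \<in> (\<real> :: complex set)" by (intro Reals_mult)
  ultimately show ?case unfolding wedge_power.simps wedge_def
    by (intro Reals_divide sum_in_Reals) auto
qed simp

section \<open>The fixed locus of the involution\<close>

theorem theorem1p1:
  fixes A :: "('a::{t2_space,second_countable_topology}, complex^'n) chart set"
    and g :: "'a \<Rightarrow> complex^'n \<Rightarrow> complex^'n \<Rightarrow> real"
    and I J\<^sub>0 K\<^sub>0 J K :: "'a \<Rightarrow> complex^'n \<Rightarrow> complex^'n"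
    and d :: nat
    and \<sigma> :: "'a \<Rightarrow> 'a"
    and \<theta> \<theta>\<^sub>J \<theta>\<^sub>K :: "'a \<Rightarrow> complex^'n \<Rightarrow> complex^'n \<Rightarrow> complex"
    and \<omega>\<^sub>I \<omega>\<^sub>J \<omega>\<^sub>K :: "'a \<Rightarrow> complex^'n \<Rightarrow> complex^'n \<Rightarrow> real"
    and S :: "'a set"
  assumes dim: "CARD('n) = 2 * d"
    and "compact (UNIV :: 'a set)"
    and "irreducible_hyperkaehler A g I J\<^sub>0 K\<^sub>0"
    and \<omega>I: "\<omega>\<^sub>I = hermitian_form g I"
    and "smooth_map A A \<sigma>" and "\<sigma> \<circ> \<sigma> = id"
    and "\<And>p u. mderiv A A \<sigma> p (I p u) = - I (\<sigma> p) (mderiv A A \<sigma> p u)"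
    and "\<And>p u v. pullback2 A \<sigma> \<omega>\<^sub>I p u v = - \<omega>\<^sub>I p u v"
    and "holomorphic_2form A I \<theta>" and "\<exists>p u v. \<theta> p u v \<noteq> 0"
    and "\<And>p u v. pullback2 A \<sigma> \<theta> p u v = cnj (\<theta> p u v)"
    and "\<And>p. form2_norm (g p) (\<theta> p) = 2 * sqrt (real d)"
    and "complex_structure A J" and "complex_structure A K"
    and "\<And>p u v. Re (\<theta> p u v) = g p (J p u) v"
    and "\<And>p u v. Im (\<theta> p u v) = g p (K p u) v"
    and \<omega>J: "\<omega>\<^sub>J = (\<lambda>p u v. Re (\<theta> p u v))"
    and \<omega>K: "\<omega>\<^sub>K = (\<lambda>p u v. Im (\<theta> p u v))"
    and \<theta>J: "\<theta>\<^sub>J = (\<lambda>p u v. of_real (\<omega>\<^sub>K p u v) + \<i> * of_real (\<omega>\<^sub>I p u v))"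
    and \<theta>K: "\<theta>\<^sub>K = (\<lambda>p u v. of_real (\<omega>\<^sub>J p u v) + \<i> * of_real (\<omega>\<^sub>I p u v))"
    and S: "S = {p. \<sigma> p = p}" and "S \<noteq> {}"
  shows "special_lagrangian A d \<omega>\<^sub>I (\<lambda>p. wedge_power (\<theta> p) d) S \<and>
         special_lagrangian A d \<omega>\<^sub>K (\<lambda>p. wedge_power (\<theta>\<^sub>K p) d) S \<and>
         complex_lagrangian A d J \<theta>\<^sub>J S"
proof -
  note hk = assms(3) and \<sigma> = assms(5) and invol = assms(6) and antihol = assms(7) and pull_\<omega> = assms(8)
    and hol\<theta> = assms(9) and pull_\<theta> = assms(11) and csJ = assms(13) and Re\<theta> = assms(15) and Im\<theta> = assms(16)
  have A: "smooth_structure A" and kI: "kaehler A g I"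
    using hk by (auto simp: irreducible_hyperkaehler_def hyperkaehler_def)
  have gpos: "g p u u > 0" if "u \<noteq> 0" for p u
    using kI that by (simp add: kaehler_def riemannian_metric_def)
  have gbil: "bilinear (g p)" for p
    using kI by (simp add: kaehler_def riemannian_metric_def smooth_bilinear_field_def)
  have II: "I p (I p u) = - u" for p u
    using kI by (simp add: kaehler_def complex_structure_def)
  have linI: "linear (I p)" for p
    using kI by (simp add: kaehler_def complex_structure_def smooth_endo_field_def)
  have linJ: "linear (J p)" for p
    using csJ by (simp add: complex_structure_def smooth_endo_field_def)
  have nondeg: "u = w" if "\<And>v. g p u v = g p w v" for p u w
  proof (rule ccontr)
    assume "u \<noteq> w"
    then have "g p (u - w) (u - w) > 0" using gpos by simp
    then show False using that bilinear_lsub[OF gbil] by simp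
  qed
  define D where "D = mderiv A A \<sigma>"
  have linD: "linear (D p)" for p unfolding D_def by (rule linear_mderiv[OF A \<sigma>])
  have \<sigma>\<sigma>: "\<sigma> (\<sigma> p) = p" for p using invol by (metis comp_apply id_apply)
  have DD: "D (\<sigma> p) (D p u) = u" for p u unfolding D_def by (rule mderiv_involution[OF A \<sigma> invol])
  \<comment> \<open>\<open>\<sigma>\<close> reverses both \<open>\<omega>\<^sub>I\<close> and \<open>I\<close>, hence preserves the metric \<open>g u v = - \<omega>\<^sub>I (I u) v\<close>.\<close>
  have D_isometry: "g (\<sigma> p) (D p u) (D p v) = g p u v" for p u v
  proof -
    have "I (\<sigma> p) (D p (I p u)) = D p u"
      using antihol[of p u] linear_neg[OF linI] by (simp add: D_def II)
    then show ?thesis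
      using pull_\<omega>[of p "I p u" v] bilinear_lneg[OF gbil]
      by (simp add: pullback2_def \<omega>I hermitian_form_def D_def II)
  qed
  \<comment> \<open>\<open>\<sigma>\<close> preserves \<open>g\<close> and \<open>Re \<theta>\<close>, hence it is holomorphic for \<open>J\<close>.\<close>
  have DJ: "D p (J p u) = J (\<sigma> p) (D p u)" for p u
  proof (rule nondeg)
    fix v
    have v: "v = D p (D (\<sigma> p) v)" using DD[of "\<sigma> p" v] by (simp add: \<sigma>\<sigma>)
    have "g (\<sigma> p) (J (\<sigma> p) (D p u)) (D p w) = g p (J p u) w" for w
      using arg_cong[OF pull_\<theta>[of p u w], of Re] by (simp add: pullback2_def Re\<theta> D_def)
    then show "g (\<sigma> p) (D p (J p u)) v = g (\<sigma> p) (J (\<sigma> p) (D p u)) v"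
      by (subst (1 2) v) (simp add: D_isometry)
  qed
  have tangent: "D p u = u" if "p \<in> S" "u \<in> tangent_of A S p" for p u
    using tangent_of_fixed_points[OF A \<sigma>] that by (simp add: S D_def)
  have \<omega>I0: "\<omega>\<^sub>I p u v = 0" and \<omega>K0: "\<omega>\<^sub>K p u v = 0"
    if "p \<in> S" "u \<in> tangent_of A S p" "v \<in> tangent_of A S p" for p u v
  proof -
    have uv: "\<sigma> p = p" "D p u = u" "D p v = v" using that tangent by (auto simp: S)
    show "\<omega>\<^sub>I p u v = 0" using pull_\<omega>[of p u v] uv by (simp add: pullback2_def D_def)
    have "Im (\<theta> p u v) = - Im (\<theta> p u v)"
      using arg_cong[OF pull_\<theta>[of p u v], of Im] uv by (simp add: pullback2_def D_def)
    then show "\<omega>\<^sub>K p u v = 0" by (simp add: \<omega>K)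
  qed
  have real: "Im (wedge_power (\<theta> p) d v) = 0" "Im (wedge_power (\<theta>\<^sub>K p) d v) = 0"
    if p: "p \<in> S" and v: "\<forall>i<2 * d. v i \<in> tangent_of A S p" for p v
  proof -
    have "\<theta> p u w \<in> \<real>" "\<theta>\<^sub>K p u w \<in> \<real>"
      if "u \<in> tangent_of A S p" "w \<in> tangent_of A S p" for u w
      using \<omega>I0[OF p that] \<omega>K0[OF p that] by (simp_all add: complex_is_Real_iff \<omega>K \<theta>K)
    then show "Im (wedge_power (\<theta> p) d v) = 0" "Im (wedge_power (\<theta>\<^sub>K p) d v) = 0"
      using wedge_power_real[where T = "tangent_of A S p"] v unfolding complex_is_Real_iff by blast+
  qed
  have slices: "\<exists>c V. holomorphic_chart A J c \<and> slice_chart A S c V \<and> p \<in> fst c \<and>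
      dim V = 2 * d \<and> vec.subspace V \<and> vec.dim V = d" if p: "p \<in> S" for p
  proof -
    have fix_p: "\<sigma> p = p" using p by (simp add: S)
    obtain c where hc: "holomorphic_chart A J c" and pc: "p \<in> fst c"
      using csJ unfolding complex_structure_def by meson
    have c: "c \<in> A" using hc by (simp add: holomorphic_chart_def)
    define L where "L = loc_deriv \<sigma> c c p"
    obtain c' where c': "c' \<in> A" "p \<in> fst c'" "fst c' \<subseteq> fst c" "\<forall>q\<in>fst c'. \<sigma> q \<in> fst c"
      and slice: "snd c' ` (fst c' \<inter> {q. \<sigma> q = q}) = snd c' ` fst c' \<inter> {v. L v = v}"
      and coords': "\<forall>q\<in>fst c'. \<forall>v.
        coords A c' q v = (1/2) *\<^sub>R (coords A c q v + L (loc_deriv \<sigma> c c q (coords A c q v)))"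
      by (rule involution_linearizing_chart[OF A c pc \<sigma> invol fix_p, folded L_def]) (rule that)
    have linL: "linear L" unfolding L_def using \<sigma> c pc fix_p by (intro linear_loc_deriv) auto
    have coordsJ: "coords A c q (J q u) = \<i> *s coords A c q u" if "q \<in> fst c" for q u
      using hc that by (simp add: holomorphic_chart_def)
    have coordsD: "coords A c (\<sigma> q) (D q u) = loc_deriv \<sigma> c c q (coords A c q u)"
      if "q \<in> fst c" "\<sigma> q \<in> fst c" for q u
      unfolding D_def by (rule coords_mderiv[OF A \<sigma> c that(1) c that(2)])
    have complex_linear: "loc_deriv \<sigma> c c q (\<i> *s v) = \<i> *s loc_deriv \<sigma> c c q v"
      if "q \<in> fst c" "\<sigma> q \<in> fst c" for q v
    proof -
      define u where "u = coord_vec A c q v"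
      have v: "v = coords A c q u" unfolding u_def by (rule coords_coord_vec[OF A c that(1), symmetric])
      show ?thesis
        using coordsD[OF that, of "J q u"] coordsD[OF that, of u]
        by (simp add: v coordsJ that DJ)
    qed
    have L\<i>: "L (\<i> *s v) = \<i> *s L v" for v
      unfolding L_def using complex_linear[of p] pc fix_p by simp
    have Lcoords: "L (coords A c p u) = coords A c p (D p u)" for u
      using coordsD[of p u] pc fix_p by (simp add: L_def)
    \<comment> \<open>\<open>I\<close> in the chart \<open>c\<close>; it anticommutes with \<open>L\<close> and thus makes the fixed space half-dimensional.\<close>
    define T where "T v = coords A c p (I p (coord_vec A c p v))" for v
    have cc: "coord_vec A c p (coords A c p u) = u" "coords A c p (coord_vec A c p u) = u" for u
      using coord_vec_coords[OF A c pc] coords_coord_vec[OF A c pc] by auto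
    have LL: "L (L v) = v" for v
      using DD[of p] Lcoords by (metis cc(2) fix_p)
    have linT: "linear T"
      unfolding T_def
      using linear_compose[OF linear_compose[OF linear_coord_vec[OF A c pc] linI] linear_coords[OF A c pc]]
      by (simp add: o_def)
    have TT: "T (T v) = - v" for v
      by (simp add: T_def cc II linear_neg[OF linear_coords[OF A c pc]])
    have injT: "inj T" by (metis TT injI neg_equal_iff_equal)
    have LT: "L (T v) = - T (L v)" for v
    proof -
      have "L (T v) = coords A c p (D p (I p (coord_vec A c p v)))" by (simp add: T_def Lcoords)
      also have "\<dots> = coords A c p (- I p (D p (coord_vec A c p v)))"
        using antihol[of p] fix_p by (simp add: D_def)
      also have "\<dots> = - T (coords A c p (D p (coord_vec A c p v)))"
        by (simp add: T_def cc linear_neg[OF linear_coords[OF A c pc]])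
      also have "\<dots> = - T (L v)" by (simp add: cc flip: Lcoords)
      finally show ?thesis .
    qed
    have "2 * dim {v. L v = v} = DIM(complex^'n)"
      by (rule dim_fixed_space_of_involution[OF linL LL linT injT LT])
    then have dimV: "dim {v. L v = v} = 2 * d" using dim by simp
    \<comment> \<open>In the chart \<open>c\<close> the structure \<open>J\<close> is multiplication by \<open>\<i>\<close>, so \<open>L\<close> is complex linear.\<close>
    have "L (z *s v) = z *s v" if "L v = v" for z v
    proof -
      have z: "z *s w = Re z *\<^sub>R w + Im z *\<^sub>R (\<i> *s w)" for w :: "complex^'n"
        by (simp add: vec_eq_iff complex_eq_iff)
      show ?thesis
        unfolding z by (simp add: linear_add[OF linL] linear_scale[OF linL] L\<i> that)
    qed
    then have subV: "vec.subspace {v. L v = v}"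
      by (auto simp: vec.subspace_def linear_0[OF linL] linear_add[OF linL])
    have "coords A c' q (J q u) = \<i> *s coords A c' q u" if q: "q \<in> fst c'" for q u
    proof -
      have q': "q \<in> fst c" "\<sigma> q \<in> fst c" using c'(3,4) q by auto
      show ?thesis
        by (simp add: coords'[rule_format, OF q] coordsJ q' complex_linear L\<i> vec.scale_right_distrib
            scaleR_eq_complex_scale vec.scale_left_commute mult.commute)
    qed
    then have "holomorphic_chart A J c'" using c'(1) by (simp add: holomorphic_chart_def)
    moreover have "slice_chart A S c' {v. L v = v}"
      unfolding slice_chart_def using c'(1) slice linL
      by (auto simp: S subspace_def linear_0 linear_add linear_scale)
    moreover have "vec.dim {v. L v = v} = d" using dim_eq_twice_complex_dim[OF subV] dimV by simp
    ultimately show ?thesis using c'(2) dimV subV by blast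
  qed
  have "submanifold A (2 * d) S" unfolding submanifold_def using slices by blast
  moreover have "complex_submanifold A J d S" unfolding complex_submanifold_def using slices by blast
  ultimately show ?thesis
    unfolding special_lagrangian_def complex_lagrangian_def
    using \<omega>I0 \<omega>K0 real by (auto simp: \<theta>J)
qed

end
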